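(* Let $A$ be a regular weak multiplier Hopf algebra with counit $\varepsilon$, and let $I=\mathrm{Ker}\,\varepsilon$. If there exists a non-zero element $h\in A$ such that $ah=0$ for any $a\in I$, then $A$ has a (left) cointegral.
   Context: All algebras are over $\mathbb{C}$, associative, possibly non-unital, with non-degenerate product. $A$ is idempotent if $A^2=A$; $M(A)$ is the multiplier algebra (identity $1$). A coproduct is a homomorphism $\Delta:A\to M(A\otimes A)$ with $\Delta(a)(1\otimes b),(a\otimes 1)\Delta(b)\in A\otimes A$, coassociative: $(a\otimes1\otimes1)(\Delta\otimes id)(\Delta(b)(1\otimes c))=(id\otimes\Delta)((a\otimes1)\Delta(b))(1\otimes1\otimes c)$. Put $T_1(a\otimes b)=\Delta(a)(1\otimes b)$, $T_2(a\otimes b)=(a\otimes1)\Delta(b)$. $\Delta$ is full if the smallest subspaces $V,W\subset A$ with $\Delta(A)(1\otimes A)\subset V\otimes A$ and $(A\otimes1)\Delta(A)\subset A\otimes W$ both equal $A$. A counit is a linear functional $\varepsilon$ with $(\varepsilon\otimes id)(\Delta(a)(1\otimes b))=ab$, $(id\otimes\varepsilon)((c\otimes1)\Delta(a))=ca$. A weak multiplier Hopf algebra is a non-degenerate idempotent algebra $A$ with a full coproduct $\Delta$ and a counit $\varepsilon$ such that: (i) there is an idempotent $E\in M(A\otimes A)$ with $T_1(A\otimes A)=E(A\otimes A)$, $T_2(A\otimes A)=(A\otimes A)E$; (ii) $(id\otimes\Delta)E=(E\otimes1)(1\otimes E)=(1\otimes E)(E\otimes1)$; (iii) $\mathrm{Ker}(T_i)=(1-G_i)(A\otimes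 A)$, $i=1,2$, where $G_1,G_2$ are the linear maps on $A\otimes A$ given by $(G_1\otimes id)(\Delta_{13}(a)(1\otimes b\otimes c))=\Delta_{13}(a)(1\otimes E)(1\otimes b\otimes c)$ and $(id\otimes G_2)((a\otimes b\otimes1)\Delta_{13}(c))=(a\otimes b\otimes1)(E\otimes1)\Delta_{13}(c)$. Here $\Delta$ (and likewise $id\otimes\Delta$) is uniquely extended to multipliers, with $\Delta(1)=E$. With Sweedler notation $\Delta(a)=\sum a_{(1)}\otimes a_{(2)}$, the antipode $S$ is the non-degenerate anti-homomorphism $A\to M(A)$ with $E(a\otimes b)=\sum a_{(1)}\otimes a_{(2)}S(a_{(3)})b$, $(a\otimes b)E=\sum aS(b_{(1)})b_{(2)}\otimes b_{(3)}$, $G_1(a\otimes b)=\sum a_{(1)}\otimes S(a_{(2)})a_{(3)}b$, $G_2(a\otimes b)=\sum ab_{(1)}S(b_{(2)})\otimes b_{(3)}$, $\sum S(a_{(1)})a_{(2)}S(a_{(3)})=S(a)$; it extends to $M(A)$. $A$ is regular if $S$ is bijective from $A$ to $A$; then also $\Delta(a)(b\otimes1),(1\otimes a)\Delta(b)\in A\otimes A$. Put $\varepsilon_t(a)=\sum a_{(1)}S(a_{(2)})$. A left cointegral is a non-zero $h\in M(A)$ with $ah=\varepsilon_t(a)h$ for all $a\in A$. *)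

theory Defs
  imports Complex_Main
begin

section \<open>Complex vector spaces and non-unital complex algebras\<close>

class scaleC =
  fixes scaleC :: "complex \<Rightarrow> 'a \<Rightarrow> 'a" (infixr \<open>*\<^sub>C\<close> 75)

class complex_vector = scaleC + ab_group_add +
  assumes scaleC_add_right: "a *\<^sub>C (x + y) = a *\<^sub>C x + a *\<^sub>C y"
    and scaleC_add_left: "(a + b) *\<^sub>C x = a *\<^sub>C x + b *\<^sub>C x"
    and scaleC_scaleC: "a *\<^sub>C b *\<^sub>C x = (a * b) *\<^sub>C x"
    and scaleC_one: "1 *\<^sub>C x = x"

class complex_algebra = complex_vector + ring +
  assumes mult_scaleC_left: "a *\<^sub>C x * y = a *\<^sub>C (x * y)"
    and mult_scaleC_right: "x * a *\<^sub>C y = a *\<^sub>C (x * y)"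

instantiation complex :: complex_algebra
begin
definition scaleC_complex :: "complex \<Rightarrow> complex \<Rightarrow> complex" where
  "scaleC_complex a x = a * x"
instance
  by standard (simp_all add: scaleC_complex_def algebra_simps)
end

global_interpretation complex_vector:
  vector_space "scaleC :: complex \<Rightarrow> 'a \<Rightarrow> 'a::complex_vector"
  by unfold_locales (rule scaleC_add_right scaleC_add_left scaleC_scaleC scaleC_one)+

global_interpretation complex_vector_pair:
  vector_space_pair "scaleC :: complex \<Rightarrow> 'a \<Rightarrow> 'a::complex_vector"
    "scaleC :: complex \<Rightarrow> 'b \<Rightarrow> 'b::complex_vector"
  by unfold_locales

abbreviation clinear :: "('a::complex_vector \<Rightarrow> 'b::complex_vector) \<Rightarrow> bool" where
  "clinear \<equiv> Vector_Spaces.linear scaleC scaleC"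

lemma clinear_iff:
  "clinear f \<longleftrightarrow> (\<forall>x y. f (x + y) = f x + f y) \<and> (\<forall>c x. f (c *\<^sub>C x) = c *\<^sub>C f x)"
  by (auto simp: Vector_Spaces.linear_iff complex_vector.vector_space_axioms)

lemma clinearI:
  assumes "\<And>x y. f (x + y) = f x + f y" and "\<And>c x. f (c *\<^sub>C x) = c *\<^sub>C f x"
  shows "clinear f"
  using assms by (simp add: clinear_iff)

lemma clinear_add: "clinear f \<Longrightarrow> f (x + y) = f x + f y"
  and clinear_scaleC: "clinear f \<Longrightarrow> f (c *\<^sub>C x) = c *\<^sub>C f x"
  by (simp_all add: clinear_iff)

lemma clinear_zero: "clinear f \<Longrightarrow> f 0 = 0"
  using clinear_scaleC[of f 0 0] by simp

lemma clinear_sum_list: "clinear f \<Longrightarrow> f (sum_list xs) = sum_list (map f xs)"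
  by (induction xs) (simp_all add: clinear_zero clinear_add)

lemma clinear_functionals_separate:
  assumes "\<And>\<phi> :: 'a::complex_vector \<Rightarrow> complex. clinear \<phi> \<Longrightarrow> \<phi> x = \<phi> y"
  shows "x = y"
proof (rule ccontr)
  assume "x \<noteq> y"
  then have "complex_vector.independent {x - y}"
    by simp
  then obtain \<phi> :: "'a \<Rightarrow> complex" where \<phi>: "clinear \<phi>" "\<phi> (x - y) = 1"
    using complex_vector_pair.linear_independent_extend[of "{x - y}" "\<lambda>_. 1::complex"] by auto
  have "\<phi> x = \<phi> (x - y) + \<phi> y"
    using clinear_add[OF \<phi>(1), of "x - y" y] by simp
  then show False
    using assms[OF \<phi>(1)] \<phi>(2) by simp
qed


section \<open>Algebraic tensor products\<close>

definition cbilinear ::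
    "('a::complex_vector \<Rightarrow> 'b::complex_vector \<Rightarrow> 'c::complex_vector) \<Rightarrow> bool" where
  "cbilinear f \<longleftrightarrow> (\<forall>y. clinear (\<lambda>x. f x y)) \<and> (\<forall>x. clinear (f x))"

lemma cbilinearI:
  assumes "\<And>x x' y. f (x + x') y = f x y + f x' y" and "\<And>c x y. f (c *\<^sub>C x) y = c *\<^sub>C f x y"
    and "\<And>x y y'. f x (y + y') = f x y + f x y'" and "\<And>c x y. f x (c *\<^sub>C y) = c *\<^sub>C f x y"
  shows "cbilinear f"
  using assms by (simp add: cbilinear_def clinear_iff)

lemma cbilinearD:
  assumes "cbilinear f"
  shows "f (x + x') y = f x y + f x' y" and "f (c *\<^sub>C x) y = c *\<^sub>C f x y"
    and "f x (y + y') = f x y + f x y'" and "f x (c *\<^sub>C y) = c *\<^sub>C f x y"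
  using assms by (simp_all add: cbilinear_def clinear_iff)

text \<open>
  The tensor product is realised inside the dual of the space of bilinear forms: an elementary
  tensor is evaluation of bilinear forms at a pair, and the tensor product consists of all
  finite sums of such evaluations. Bilinear forms are enough to obtain the universal property for
  bilinear maps into every complex vector space (see \<open>lift_tensor\<close>, \<open>lift_clinear\<close> and
  \<open>tensor_universal\<close> below), because linear functionals separate points.
\<close>

definition evaluate_at :: "'a::complex_vector \<Rightarrow> 'b::complex_vector \<Rightarrow> ('a \<Rightarrow> 'b \<Rightarrow> complex) \<Rightarrow> complex" where
  "evaluate_at a b = (\<lambda>\<beta>. if cbilinear \<beta> then \<beta> a b else 0)"

definition evaluate_sum ::
    "('a::complex_vector \<times> 'b::complex_vector) list \<Rightarrow> ('a \<Rightarrow> 'b \<Rightarrow> complex) \<Rightarrow> complex" where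
  "evaluate_sum xs = (\<lambda>\<beta>. \<Sum>(a, b)\<leftarrow>xs. evaluate_at a b \<beta>)"

typedef (overloaded) ('a, 'b) tensor (\<open>(_ \<otimes>/ _)\<close> [21, 20] 20) =
  "range (evaluate_sum :: ('a::complex_vector \<times> 'b::complex_vector) list \<Rightarrow> _)"
  by blast

setup_lifting type_definition_tensor

lemma evaluate_sum_simps:
  "evaluate_sum [] \<beta> = 0"
  "evaluate_sum ((a, b) # xs) \<beta> = evaluate_at a b \<beta> + evaluate_sum xs \<beta>"
  "evaluate_sum (xs @ ys) \<beta> = evaluate_sum xs \<beta> + evaluate_sum ys \<beta>"
  by (simp_all add: evaluate_sum_def)

lemma evaluate_sum_scale:
  "evaluate_sum (map (\<lambda>(a, b). (c *\<^sub>C a, b)) xs) \<beta> = c * evaluate_sum xs \<beta>"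
  by (induction xs)
    (auto simp: evaluate_sum_simps evaluate_at_def cbilinearD scaleC_complex_def algebra_simps)

lift_definition tensor :: "'a::complex_vector \<Rightarrow> 'b::complex_vector \<Rightarrow> 'a \<otimes> 'b" (infixr \<open>\<otimes>\<close> 71)
  is evaluate_at
proof -
  fix a :: 'a and b :: 'b
  have "evaluate_at a b = evaluate_sum [(a, b)]"
    by (simp add: fun_eq_iff evaluate_sum_simps)
  then show "evaluate_at a b \<in> range evaluate_sum" by simp
qed

instantiation tensor :: (complex_vector, complex_vector) complex_vector
begin

lift_definition zero_tensor :: "'a \<otimes> 'b" is "\<lambda>_. 0"
proof -
  have "(\<lambda>_. 0) = evaluate_sum ([] :: ('a \<times> 'b) list)"
    by (simp add: fun_eq_iff evaluate_sum_simps)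
  then show "(\<lambda>_. 0) \<in> range (evaluate_sum :: ('a \<times> 'b) list \<Rightarrow> _)" by (rule range_eqI)
qed

lift_definition plus_tensor :: "'a \<otimes> 'b \<Rightarrow> 'a \<otimes> 'b \<Rightarrow> 'a \<otimes> 'b" is "\<lambda>s t \<beta>. s \<beta> + t \<beta>"
proof -
  fix s t :: "('a \<Rightarrow> 'b \<Rightarrow> complex) \<Rightarrow> complex"
  assume "s \<in> range evaluate_sum" "t \<in> range evaluate_sum"
  then obtain xs ys where "s = evaluate_sum xs" "t = evaluate_sum ys" by blast
  then have "(\<lambda>\<beta>. s \<beta> + t \<beta>) = evaluate_sum (xs @ ys)"
    by (simp add: fun_eq_iff evaluate_sum_simps)
  then show "(\<lambda>\<beta>. s \<beta> + t \<beta>) \<in> range evaluate_sum" by simp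
qed

lift_definition scaleC_tensor :: "complex \<Rightarrow> 'a \<otimes> 'b \<Rightarrow> 'a \<otimes> 'b" is "\<lambda>c t \<beta>. c * t \<beta>"
proof -
  fix c and t :: "('a \<Rightarrow> 'b \<Rightarrow> complex) \<Rightarrow> complex"
  assume "t \<in> range evaluate_sum"
  then obtain xs where "t = evaluate_sum xs" by blast
  then have "(\<lambda>\<beta>. c * t \<beta>) = evaluate_sum (map (\<lambda>(a, b). (c *\<^sub>C a, b)) xs)"
    by (simp add: fun_eq_iff evaluate_sum_scale)
  then show "(\<lambda>\<beta>. c * t \<beta>) \<in> range evaluate_sum" by simp
qed

definition uminus_tensor :: "'a \<otimes> 'b \<Rightarrow> 'a \<otimes> 'b" where
  "uminus_tensor t = (- 1) *\<^sub>C t"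

definition minus_tensor :: "'a \<otimes> 'b \<Rightarrow> 'a \<otimes> 'b \<Rightarrow> 'a \<otimes> 'b" where
  "minus_tensor s t = s + (- t)"

instance
proof
  fix a b c :: "'a \<otimes> 'b"
  show "- a + a = 0"
    unfolding uminus_tensor_def by transfer simp
qed (simp add: minus_tensor_def | transfer, simp add: algebra_simps)+

end

lemma cbilinear_tensor: "cbilinear ((\<otimes>) :: 'a::complex_vector \<Rightarrow> 'b::complex_vector \<Rightarrow> _)"
  by (rule cbilinearI; transfer)
    (simp_all add: evaluate_at_def fun_eq_iff cbilinearD scaleC_complex_def)

lemma tensor_eq_sum_list:
  obtains xs where "t = (\<Sum>(a, b)\<leftarrow>xs. a \<otimes> b)"
proof -
  obtain xs where xs: "Rep_tensor t = evaluate_sum xs"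
    using Rep_tensor[of t] by blast
  have "Rep_tensor (\<Sum>(a, b)\<leftarrow>ys. a \<otimes> b) = evaluate_sum ys" for ys :: "('a \<times> 'b) list"
    by (induction ys)
      (auto simp: zero_tensor.rep_eq plus_tensor.rep_eq tensor.rep_eq fun_eq_iff evaluate_sum_simps)
  then have "t = (\<Sum>(a, b)\<leftarrow>xs. a \<otimes> b)"
    using xs by (simp add: Rep_tensor_inject[symmetric])
  then show thesis by (rule that)
qed

lemma tensor_induct [case_names tensor add]:
  assumes "\<And>a b. P (a \<otimes> b)" and "\<And>s t. P s \<Longrightarrow> P t \<Longrightarrow> P (s + t)"
  shows "P t"
proof -
  have zero: "P 0"
    using assms(1)[of 0 0] cbilinearD(2)[OF cbilinear_tensor, of 0 "0 :: 'a" "0 :: 'b"]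
    by (simp del: complex_vector.scale_zero_right)
  obtain xs where t: "t = (\<Sum>(a, b)\<leftarrow>xs. a \<otimes> b)" by (rule tensor_eq_sum_list)
  show ?thesis
    unfolding t by (induction xs) (auto simp: zero assms)
qed

definition lift :: "('a::complex_vector \<Rightarrow> 'b::complex_vector \<Rightarrow> 'c::complex_vector) \<Rightarrow> 'a \<otimes> 'b \<Rightarrow> 'c" where
  "lift f t = (\<Sum>(a, b)\<leftarrow>(SOME xs. t = (\<Sum>(a, b)\<leftarrow>xs. a \<otimes> b)). f a b)"

lemma lift_sum_list:
  fixes f :: "'a::complex_vector \<Rightarrow> 'b::complex_vector \<Rightarrow> 'c::complex_vector"
  assumes f: "cbilinear f"
  shows "lift f (\<Sum>(a, b)\<leftarrow>xs. a \<otimes> b) = (\<Sum>(a, b)\<leftarrow>xs. f a b)"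
proof -
  let ?t = "\<Sum>(a, b)\<leftarrow>xs. a \<otimes> b"
  define ys where "ys = (SOME ys. ?t = (\<Sum>(a, b)\<leftarrow>ys. a \<otimes> b))"
  have ys: "?t = (\<Sum>(a, b)\<leftarrow>ys. a \<otimes> b)"
    unfolding ys_def by (rule someI[of _ xs]) simp
  have "(\<Sum>(a, b)\<leftarrow>ys. f a b) = (\<Sum>(a, b)\<leftarrow>xs. f a b)"
  proof (rule clinear_functionals_separate)
    fix \<phi> :: "'c \<Rightarrow> complex" assume \<phi>: "clinear \<phi>"
    define \<beta> where "\<beta> = (\<lambda>a b. \<phi> (f a b))"
    have \<beta>: "cbilinear \<beta>"
      unfolding \<beta>_def
      by (rule cbilinearI) (simp_all add: cbilinearD[OF f] clinear_add[OF \<phi>] clinear_scaleC[OF \<phi>])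
    have eval: "\<phi> (\<Sum>(a, b)\<leftarrow>zs. f a b) = Rep_tensor (\<Sum>(a, b)\<leftarrow>zs. a \<otimes> b) \<beta>" for zs
      by (induction zs)
        (use \<beta> in \<open>auto simp: zero_tensor.rep_eq plus_tensor.rep_eq tensor.rep_eq evaluate_at_def
          clinear_zero[OF \<phi>] clinear_add[OF \<phi>] \<beta>_def\<close>)
    show "\<phi> (\<Sum>(a, b)\<leftarrow>ys. f a b) = \<phi> (\<Sum>(a, b)\<leftarrow>xs. f a b)"
      unfolding eval ys ..
  qed
  then show ?thesis
    unfolding lift_def ys_def[symmetric] .
qed

lemma lift_tensor [simp]: "cbilinear f \<Longrightarrow> lift f (a \<otimes> b) = f a b"
  using lift_sum_list[of f "[(a, b)]"] by simp

lemma lift_clinear: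
  fixes f :: "'a::complex_vector \<Rightarrow> 'b::complex_vector \<Rightarrow> 'c::complex_vector"
  assumes f: "cbilinear f"
  shows "clinear (lift f)"
proof (rule clinearI)
  fix s t :: "'a \<otimes> 'b"
  obtain xs ys where "s = (\<Sum>(a, b)\<leftarrow>xs. a \<otimes> b)" "t = (\<Sum>(a, b)\<leftarrow>ys. a \<otimes> b)"
    by (metis tensor_eq_sum_list)
  then show "lift f (s + t) = lift f s + lift f t"
    using lift_sum_list[OF f, of "xs @ ys"] by (simp add: lift_sum_list[OF f])
next
  fix c and t :: "'a \<otimes> 'b"
  obtain xs where t: "t = (\<Sum>(a, b)\<leftarrow>xs. a \<otimes> b)"
    by (rule tensor_eq_sum_list)
  have "c *\<^sub>C (\<Sum>(a, b)\<leftarrow>xs. a \<otimes> b) = (\<Sum>(a, b)\<leftarrow>map (\<lambda>(a, b). (c *\<^sub>C a, b)) xs. a \<otimes> b)"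
    by (induction xs) (auto simp: scaleC_add_right cbilinearD[OF cbilinear_tensor])
  moreover have "c *\<^sub>C (\<Sum>(a, b)\<leftarrow>xs. f a b) = (\<Sum>(a, b)\<leftarrow>map (\<lambda>(a, b). (c *\<^sub>C a, b)) xs. f a b)"
    by (induction xs) (auto simp: scaleC_add_right cbilinearD[OF f])
  ultimately show "lift f (c *\<^sub>C t) = c *\<^sub>C lift f t"
    unfolding t by (simp only: lift_sum_list[OF f])
qed

lemma tensor_ext:
  assumes "clinear f" "clinear g" and "\<And>a b. f (a \<otimes> b) = g (a \<otimes> b)"
  shows "f t = g t"
  by (induction t rule: tensor_induct) (simp_all add: assms clinear_add)

lemma tensor_universal:
  assumes "cbilinear f"
  shows "\<exists>!F. clinear F \<and> (\<forall>a b. F (a \<otimes> b) = f a b)"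
proof (rule ex1I)
  show "clinear (lift f) \<and> (\<forall>a b. lift f (a \<otimes> b) = f a b)"
    using assms by (simp add: lift_clinear)
next
  fix F assume F: "clinear F \<and> (\<forall>a b. F (a \<otimes> b) = f a b)"
  show "F = lift f"
  proof
    fix t show "F t = lift f t"
      by (rule tensor_ext) (use F assms in \<open>simp_all add: lift_clinear\<close>)
  qed
qed

definition tensor_map ::
    "('a::complex_vector \<Rightarrow> 'c::complex_vector) \<Rightarrow> ('b::complex_vector \<Rightarrow> 'd::complex_vector) \<Rightarrow> 'a \<otimes> 'b \<Rightarrow> 'c \<otimes> 'd" where
  "tensor_map f g = lift (\<lambda>a b. f a \<otimes> g b)"

lemma cbilinear_tensor_map:
  "clinear f \<Longrightarrow> clinear g \<Longrightarrow> cbilinear (\<lambda>a b. f a \<otimes> g b)"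
  by (rule cbilinearI)
    (simp_all add: clinear_add clinear_scaleC cbilinearD[OF cbilinear_tensor])

lemma tensor_map_tensor [simp]:
  "clinear f \<Longrightarrow> clinear g \<Longrightarrow> tensor_map f g (a \<otimes> b) = f a \<otimes> g b"
  by (simp add: tensor_map_def cbilinear_tensor_map)

lemma clinear_tensor_map: "clinear f \<Longrightarrow> clinear g \<Longrightarrow> clinear (tensor_map f g)"
  by (simp add: tensor_map_def cbilinear_tensor_map lift_clinear)

lemma clinear_mult_left: "clinear (\<lambda>y. x * y)"
  and clinear_mult_right: "clinear (\<lambda>x. x * y)"
  for x y :: "'a::complex_algebra"
  by (simp_all add: clinear_iff algebra_simps mult_scaleC_left mult_scaleC_right)

lemma lift_add:
  assumes f: "cbilinear f" and g: "cbilinear g"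
  shows "lift (\<lambda>a b. f a b + g a b) t = lift f t + lift g t"
proof -
  have h: "cbilinear (\<lambda>a b. f a b + g a b)"
    by (rule cbilinearI) (simp_all add: cbilinearD[OF f] cbilinearD[OF g] algebra_simps scaleC_add_right)
  show ?thesis
    by (rule tensor_ext[OF lift_clinear[OF h]])
      (simp_all add: f g h clinear_iff lift_clinear clinear_add[OF lift_clinear]
        clinear_scaleC[OF lift_clinear] algebra_simps scaleC_add_right)
qed

lemma lift_scaleC:
  assumes f: "cbilinear f"
  shows "lift (\<lambda>a b. c *\<^sub>C f a b) t = c *\<^sub>C lift f t"
proof -
  have h: "cbilinear (\<lambda>a b. c *\<^sub>C f a b)"
    by (rule cbilinearI) (simp_all add: cbilinearD[OF f] scaleC_add_right scaleC_scaleC mult.commute)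
  show ?thesis
    by (rule tensor_ext[OF lift_clinear[OF h]])
      (simp_all add: f h clinear_iff clinear_add[OF lift_clinear]
        clinear_scaleC[OF lift_clinear] scaleC_add_right scaleC_scaleC mult.commute)
qed

lemma cbilinear_lift:
  assumes "\<And>s. cbilinear (f s)" and "\<And>a b. clinear (\<lambda>s. f s a b)"
  shows "cbilinear (\<lambda>s. lift (f s))"
proof (rule cbilinearI)
  fix s s' t
  have "f (s + s') = (\<lambda>a b. f s a b + f s' a b)"
    by (simp add: fun_eq_iff clinear_add[OF assms(2)])
  then show "lift (f (s + s')) t = lift (f s) t + lift (f s') t"
    by (simp only: lift_add assms(1))
next
  fix c s t
  have "f (c *\<^sub>C s) = (\<lambda>a b. c *\<^sub>C f s a b)"
    by (simp add: fun_eq_iff clinear_scaleC[OF assms(2)])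
  then show "lift (f (c *\<^sub>C s)) t = c *\<^sub>C lift (f s) t"
    by (simp only: lift_scaleC assms(1))
qed (simp_all add: assms clinear_add[OF lift_clinear] clinear_scaleC[OF lift_clinear])

instantiation tensor :: (complex_algebra, complex_algebra) complex_algebra
begin

definition times_tensor :: "'a \<otimes> 'b \<Rightarrow> 'a \<otimes> 'b \<Rightarrow> 'a \<otimes> 'b" where
  "times_tensor s t = lift (\<lambda>a b. tensor_map (\<lambda>x. a * x) (\<lambda>y. b * y) t) s"

lemma times_tensor_aux1:
  "cbilinear (\<lambda>a b. tensor_map (\<lambda>x. a * x) (\<lambda>y. b * y) (t :: 'a \<otimes> 'b))"
proof -
  have bil: "cbilinear (\<lambda>x y. (a * x) \<otimes> (b * y))" for a :: 'a and b :: 'b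
    by (rule cbilinear_tensor_map[OF clinear_mult_left clinear_mult_left])
  show ?thesis
    unfolding tensor_map_def
    by (rule cbilinearI)
      (simp_all add: algebra_simps mult_scaleC_left cbilinearD[OF cbilinear_tensor] bil
        lift_add[symmetric] lift_scaleC[symmetric] del: lift_tensor)
qed

lemma times_tensor_aux2: "clinear (\<lambda>s. s * (t :: 'a \<otimes> 'b))"
  unfolding times_tensor_def by (rule lift_clinear[OF times_tensor_aux1])

lemma times_tensor_aux3: "(a \<otimes> b) * t = tensor_map (\<lambda>x. a * x) (\<lambda>y. b * y) t"
  for t :: "'a \<otimes> 'b"
  unfolding times_tensor_def by (simp add: times_tensor_aux1)

lemma times_tensor_aux4: "clinear (\<lambda>t. s * (t :: 'a \<otimes> 'b))"
proof (rule clinearI)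
  fix t u :: "'a \<otimes> 'b"
  show "s * (t + u) = s * t + s * u"
    by (induction s rule: tensor_induct)
      (simp_all add: times_tensor_aux3 clinear_add[OF clinear_tensor_map] clinear_mult_left
        clinear_add[OF times_tensor_aux2] algebra_simps)
next
  fix c and t :: "'a \<otimes> 'b"
  show "s * c *\<^sub>C t = c *\<^sub>C (s * t)"
    by (induction s rule: tensor_induct)
      (simp_all add: times_tensor_aux3 clinear_scaleC[OF clinear_tensor_map] clinear_mult_left
        clinear_add[OF times_tensor_aux2] scaleC_add_right)
qed

lemma tensor_times_tensor_aux: "(a \<otimes> b) * (c \<otimes> d) = (a * c) \<otimes> (b * d)"
  for a c :: 'a and b d :: 'b
  by (simp add: times_tensor_aux3 clinear_mult_left)

instance
proof
  fix s t u :: "'a \<otimes> 'b" and c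
  note add = clinear_add[OF times_tensor_aux2] clinear_add[OF times_tensor_aux4]
  show "s * t * u = s * (t * u)"
  proof (induction s rule: tensor_induct)
    case (tensor a b)
    show ?case
    proof (induction t rule: tensor_induct)
      case (tensor a' b')
      show ?case
        by (induction u rule: tensor_induct)
          (simp_all add: tensor_times_tensor_aux mult.assoc add)
    qed (simp add: add)
  qed (simp add: add)
  show "(s + t) * u = s * u + t * u" "s * (t + u) = s * t + s * u"
    by (rule add)+
  show "c *\<^sub>C s * t = c *\<^sub>C (s * t)"
    by (rule clinear_scaleC[OF times_tensor_aux2])
  show "s * c *\<^sub>C t = c *\<^sub>C (s * t)"
    by (rule clinear_scaleC[OF times_tensor_aux4])
qed

end

lemma tensor_times_tensor [simp]: "(a \<otimes> b) * (c \<otimes> d) = (a * c) \<otimes> (b * d)"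
  for a c :: "'a::complex_algebra" and b d :: "'b::complex_algebra"
  by (rule tensor_times_tensor_aux)

lemma tensor_basis_expansion:
  fixes t :: "'a::complex_vector \<otimes> 'b::complex_vector"
  assumes indep: "complex_vector.independent B" and span: "complex_vector.span B = UNIV"
  obtains F c where "finite F" "F \<subseteq> B" "t = (\<Sum>e\<in>F. e \<otimes> c e)"
proof -
  have "\<exists>F c. finite F \<and> F \<subseteq> B \<and> (\<forall>e. e \<notin> F \<longrightarrow> c e = 0) \<and> t = (\<Sum>e\<in>F. e \<otimes> c e)"
  proof (induction t rule: tensor_induct)
    case (tensor a b)
    let ?r = "complex_vector.representation B a"
    let ?F = "{e. ?r e \<noteq> 0}"
    have cl: "clinear (\<lambda>x. x \<otimes> b)"
      using cbilinear_tensor by (auto simp: cbilinear_def)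
    have "a = (\<Sum>e\<in>?F. ?r e *\<^sub>C e)"
      using indep span by (simp add: complex_vector.sum_nonzero_representation_eq)
    then have "a \<otimes> b = (\<Sum>e\<in>?F. ?r e *\<^sub>C e) \<otimes> b"
      by simp
    also have "\<dots> = (\<Sum>e\<in>?F. (?r e *\<^sub>C e) \<otimes> b)"
      by (rule complex_vector_pair.linear_sum[OF cl])
    also have "\<dots> = (\<Sum>e\<in>?F. e \<otimes> (?r e *\<^sub>C b))"
      by (simp add: cbilinearD[OF cbilinear_tensor])
    finally show ?case
      using complex_vector.finite_representation complex_vector.representation_ne_zero
      by (intro exI[of _ ?F] exI[of _ "\<lambda>e. ?r e *\<^sub>C b"]) auto
  next
    case (add s t)
    then obtain F c F' c' where
      s: "finite F" "F \<subseteq> B" "\<forall>e. e \<notin> F \<longrightarrow> c e = 0" "s = (\<Sum>e\<in>F. e \<otimes> c e)" and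
      t: "finite F'" "F' \<subseteq> B" "\<forall>e. e \<notin> F' \<longrightarrow> c' e = 0" "t = (\<Sum>e\<in>F'. e \<otimes> c' e)"
      by blast
    have zero: "(e :: 'a) \<otimes> (0 :: 'b) = 0" for e
      using cbilinearD(4)[OF cbilinear_tensor, of e 0 0] by simp
    have "s = (\<Sum>e\<in>F \<union> F'. e \<otimes> c e)" "t = (\<Sum>e\<in>F \<union> F'. e \<otimes> c' e)"
      unfolding s(4) t(4) by (rule sum.mono_neutral_left; use s t zero in auto)+
    then have "s + t = (\<Sum>e\<in>F \<union> F'. e \<otimes> (c e + c' e))"
      by (simp add: cbilinearD[OF cbilinear_tensor] sum.distrib)
    then show ?case
      using s t by (intro exI[of _ "F \<union> F'"] exI[of _ "\<lambda>e. c e + c' e"]) auto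
  qed
  then show thesis using that by blast
qed

lemma slices_separate:
  fixes t :: "'a::complex_vector \<otimes> 'b::complex_vector"
  assumes "\<And>\<phi> :: 'a \<Rightarrow> complex. clinear \<phi> \<Longrightarrow> lift (\<lambda>a b. \<phi> a *\<^sub>C b) t = 0"
  shows "t = 0"
proof -
  define B :: "'a set" where "B = complex_vector.extend_basis {}"
  have B: "complex_vector.independent B" "complex_vector.span B = UNIV"
    unfolding B_def
    by (simp_all add: complex_vector.independent_extend_basis complex_vector.span_extend_basis
        complex_vector.independent_empty)
  obtain F and c :: "'a \<Rightarrow> 'b" where F: "finite F" "F \<subseteq> B" and t: "t = (\<Sum>e\<in>F. e \<otimes> c e)"
    by (rule tensor_basis_expansion[OF B])
  have "c e = 0" if e: "e \<in> F" for e
  proof -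
    obtain \<phi> :: "'a \<Rightarrow> complex" where \<phi>: "clinear \<phi>" "\<forall>x\<in>B. \<phi> x = (if x = e then 1 else 0)"
      using complex_vector_pair.linear_independent_extend[OF B(1), of "\<lambda>x. if x = e then 1 else 0"]
      by auto
    have bil: "cbilinear (\<lambda>a b. \<phi> a *\<^sub>C (b::'b))"
      by (rule cbilinearI)
        (simp_all add: clinear_add[OF \<phi>(1)] clinear_scaleC[OF \<phi>(1)] scaleC_add_left
          scaleC_add_right scaleC_scaleC scaleC_complex_def mult.commute)
    have "0 = (\<Sum>e'\<in>F. lift (\<lambda>a b. \<phi> a *\<^sub>C b) (e' \<otimes> c e'))"
      using assms[OF \<phi>(1)] unfolding t
      by (simp only: complex_vector_pair.linear_sum[OF lift_clinear[OF bil]])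
    also have "\<dots> = (\<Sum>e'\<in>F. if e' = e then c e' else 0)"
      using F \<phi>(2) by (intro sum.cong) (auto simp: bil scaleC_one)
    also have "\<dots> = c e"
      using F e by simp
    finally show ?thesis by simp
  qed
  then show ?thesis
    unfolding t using cbilinearD(4)[OF cbilinear_tensor, of _ 0 0]
    by (intro sum.neutral) auto
qed

lemma tensor_map_separate:
  fixes t :: "'a::complex_vector \<otimes> 'b::complex_vector"
  assumes f: "\<And>i. clinear (f i :: 'a \<Rightarrow> 'c::complex_vector)" and g: "\<And>j. clinear (g j :: 'b \<Rightarrow> 'd::complex_vector)"
    and f_sep: "\<And>x. (\<And>i. f i x = 0) \<Longrightarrow> x = 0" and g_sep: "\<And>x. (\<And>j. g j x = 0) \<Longrightarrow> x = 0"
    and zero: "\<And>i j. tensor_map (f i) (g j) t = 0"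
  shows "t = 0"
proof (rule slices_separate)
  have bil1: "cbilinear (\<lambda>a b. \<phi> a *\<^sub>C b)" if "clinear \<phi>"
    for \<phi> :: "'x::complex_vector \<Rightarrow> complex"
    by (intro cbilinearI)
      (simp_all add: clinear_add[OF that] clinear_scaleC[OF that] scaleC_add_left
          scaleC_add_right scaleC_scaleC scaleC_complex_def mult.commute)
  have bil2: "cbilinear (\<lambda>a b. \<psi> b *\<^sub>C a)" if "clinear \<psi>"
    for \<psi> :: "'x::complex_vector \<Rightarrow> complex"
    by (intro cbilinearI)
      (simp_all add: clinear_add[OF that] clinear_scaleC[OF that] scaleC_add_left
          scaleC_add_right scaleC_scaleC scaleC_complex_def mult.commute)
  have exchange: "\<phi> (lift (\<lambda>a b. \<psi> b *\<^sub>C a) t) = \<psi> (lift (\<lambda>a b. \<phi> a *\<^sub>C b) t)"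
    if \<phi>: "clinear \<phi>" and \<psi>: "clinear \<psi>"
    for \<phi> :: "'x::complex_vector \<Rightarrow> complex" and \<psi> :: "'y::complex_vector \<Rightarrow> complex" and t
    by (induction t rule: tensor_induct)
      (simp_all add: bil1 bil2 \<phi> \<psi> clinear_add[OF lift_clinear] clinear_add[OF \<phi>] clinear_add[OF \<psi>]
        clinear_scaleC[OF \<phi>] clinear_scaleC[OF \<psi>] scaleC_complex_def)
  have comp: "clinear (\<lambda>x. \<phi> (h x))" if "clinear \<phi>" "clinear h"
    for \<phi> :: "'y::complex_vector \<Rightarrow> complex" and h :: "'x::complex_vector \<Rightarrow> 'y"
    using that by (simp add: clinear_iff)
  fix \<phi> :: "'a \<Rightarrow> complex" assume \<phi>: "clinear \<phi>"
  show "lift (\<lambda>a b. \<phi> a *\<^sub>C b) t = 0"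
  proof (rule g_sep)
    fix j
    show "g j (lift (\<lambda>a b. \<phi> a *\<^sub>C b) t) = 0"
    proof (rule clinear_functionals_separate)
      fix \<psi> :: "'d \<Rightarrow> complex" assume \<psi>: "clinear \<psi>"
      let ?\<psi> = "\<lambda>b. \<psi> (g j b)"
      have \<psi>': "clinear ?\<psi>" by (rule comp[OF \<psi> g])
      have "lift (\<lambda>a b. ?\<psi> b *\<^sub>C a) t = 0"
      proof (rule f_sep)
        fix i
        have "f i (lift (\<lambda>a b. ?\<psi> b *\<^sub>C a) t) = lift (\<lambda>a b. \<psi> b *\<^sub>C a) (tensor_map (f i) (g j) t)"
          by (induction t rule: tensor_induct)
            (simp_all add: bil2 \<psi> \<psi>' f g clinear_add[OF lift_clinear] clinear_add[OF f]
              clinear_add[OF clinear_tensor_map] clinear_scaleC[OF f])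
        then show "f i (lift (\<lambda>a b. ?\<psi> b *\<^sub>C a) t) = 0"
          by (simp add: zero clinear_zero[OF lift_clinear] bil2 \<psi>)
      qed
      then show "\<psi> (g j (lift (\<lambda>a b. \<phi> a *\<^sub>C b) t)) = \<psi> 0"
        using exchange[OF \<phi> \<psi>', of t] by (simp add: clinear_zero[OF \<phi>] clinear_zero[OF \<psi>])
    qed
  qed
qed

class nondegenerate_algebra = complex_algebra +
  assumes nondegenerate_left: "(\<And>b. a * b = 0) \<Longrightarrow> a = 0"
    and nondegenerate_right: "(\<And>b. b * a = 0) \<Longrightarrow> a = 0"

instance tensor :: (nondegenerate_algebra, nondegenerate_algebra) nondegenerate_algebra
proof
  fix t :: "'a \<otimes> 'b"
  assume zero: "\<And>u. t * u = 0"
  have "s * (c \<otimes> d) = tensor_map (\<lambda>x. x * c) (\<lambda>y. y * d) s" for s :: "'a \<otimes> 'b" and c d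
    by (induction s rule: tensor_induct)
      (simp_all add: clinear_mult_right clinear_add[OF clinear_tensor_map] distrib_right)
  then have eq: "tensor_map (\<lambda>x. x * c) (\<lambda>y. y * d) t = 0" for c d
    using zero by metis
  show "t = 0"
  proof (rule tensor_map_separate[of "\<lambda>c x. x * c" "\<lambda>d y. y * d"])
    show "x = 0" if "\<And>c. x * c = 0" for x :: 'a
      using that by (rule nondegenerate_left)
    show "y = 0" if "\<And>d. y * d = 0" for y :: 'b
      using that by (rule nondegenerate_left)
  qed (rule clinear_mult_right eq)+
next
  fix t :: "'a \<otimes> 'b"
  assume zero: "\<And>u. u * t = 0"
  have "(c \<otimes> d) * s = tensor_map (\<lambda>x. c * x) (\<lambda>y. d * y) s" for s :: "'a \<otimes> 'b" and c d
    by (induction s rule: tensor_induct)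
      (simp_all add: clinear_mult_left clinear_add[OF clinear_tensor_map] distrib_left)
  then have eq: "tensor_map (\<lambda>x. c * x) (\<lambda>y. d * y) t = 0" for c d
    using zero by metis
  show "t = 0"
  proof (rule tensor_map_separate[of "\<lambda>c x. c * x" "\<lambda>d y. d * y"])
    show "x = 0" if "\<And>c. c * x = 0" for x :: 'a
      using that by (rule nondegenerate_right)
    show "y = 0" if "\<And>d. d * y = 0" for y :: 'b
      using that by (rule nondegenerate_right)
  qed (rule clinear_mult_left eq)+
qed

definition algebra_hom :: "('a::complex_algebra \<Rightarrow> 'b::complex_algebra) \<Rightarrow> bool" where
  "algebra_hom f \<longleftrightarrow> clinear f \<and> (\<forall>x y. f (x * y) = f x * f y)"

definition assoc :: "('a::complex_vector \<otimes> 'b::complex_vector) \<otimes> 'c::complex_vector \<Rightarrow> 'a \<otimes> ('b \<otimes> 'c)" where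
  "assoc = lift (\<lambda>s c. lift (\<lambda>a b. a \<otimes> (b \<otimes> c)) s)"

definition unassoc :: "'a::complex_vector \<otimes> ('b::complex_vector \<otimes> 'c::complex_vector) \<Rightarrow> ('a \<otimes> 'b) \<otimes> 'c" where
  "unassoc = lift (\<lambda>a t. lift (\<lambda>b c. (a \<otimes> b) \<otimes> c) t)"

definition swap12 :: "'a::complex_vector \<otimes> ('b::complex_vector \<otimes> 'c::complex_vector) \<Rightarrow> 'b \<otimes> ('a \<otimes> 'c)" where
  "swap12 = lift (\<lambda>a t. lift (\<lambda>b c. b \<otimes> (a \<otimes> c)) t)"

lemma clinear_assoc: "clinear (assoc :: ('a::complex_vector \<otimes> 'b::complex_vector) \<otimes> 'c::complex_vector \<Rightarrow> _)"
  and assoc_tensor [simp]: "assoc (((a :: 'a) \<otimes> (b :: 'b)) \<otimes> (c :: 'c)) = a \<otimes> (b \<otimes> c)"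
proof -
  have bil: "cbilinear (\<lambda>a b. a \<otimes> (b \<otimes> c))" for c :: 'c
    by (rule cbilinearI) (simp_all add: cbilinearD[OF cbilinear_tensor])
  have "cbilinear (\<lambda>c s. lift (\<lambda>a b. a \<otimes> (b \<otimes> (c::'c))) s)"
    by (rule cbilinear_lift[OF bil]) (simp add: clinear_iff cbilinearD[OF cbilinear_tensor])
  then have bil': "cbilinear (\<lambda>s c. lift (\<lambda>a b. a \<otimes> (b \<otimes> (c::'c))) s)"
    by (auto simp: cbilinear_def)
  show "clinear (assoc :: ('a \<otimes> 'b) \<otimes> 'c \<Rightarrow> _)" "assoc ((a \<otimes> b) \<otimes> c) = a \<otimes> (b \<otimes> c)"
    unfolding assoc_def by (simp_all add: bil bil' lift_clinear)
qed

lemma clinear_unassoc: "clinear (unassoc :: 'a::complex_vector \<otimes> ('b::complex_vector \<otimes> 'c::complex_vector) \<Rightarrow> _)"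
  and unassoc_tensor [simp]: "unassoc ((a :: 'a) \<otimes> ((b :: 'b) \<otimes> (c :: 'c))) = (a \<otimes> b) \<otimes> c"
proof -
  have bil: "cbilinear (\<lambda>b c. (a \<otimes> b) \<otimes> c)" for a :: 'a
    by (rule cbilinearI) (simp_all add: cbilinearD[OF cbilinear_tensor])
  have bil': "cbilinear (\<lambda>a t. lift (\<lambda>b c. ((a::'a) \<otimes> b) \<otimes> c) t)"
    by (rule cbilinear_lift[OF bil]) (simp add: clinear_iff cbilinearD[OF cbilinear_tensor])
  show "clinear (unassoc :: 'a \<otimes> ('b \<otimes> 'c) \<Rightarrow> _)" "unassoc (a \<otimes> (b \<otimes> c)) = (a \<otimes> b) \<otimes> c"
    unfolding unassoc_def by (simp_all add: bil bil' lift_clinear)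
qed

lemma clinear_swap12: "clinear (swap12 :: 'a::complex_vector \<otimes> ('b::complex_vector \<otimes> 'c::complex_vector) \<Rightarrow> _)"
  and swap12_tensor [simp]: "swap12 ((a :: 'a) \<otimes> ((b :: 'b) \<otimes> (c :: 'c))) = b \<otimes> (a \<otimes> c)"
proof -
  have bil: "cbilinear (\<lambda>b c. b \<otimes> (a \<otimes> c))" for a :: 'a
    by (rule cbilinearI) (simp_all add: cbilinearD[OF cbilinear_tensor])
  have bil': "cbilinear (\<lambda>a t. lift (\<lambda>b c. b \<otimes> ((a::'a) \<otimes> c)) t)"
    by (rule cbilinear_lift[OF bil]) (simp add: clinear_iff cbilinearD[OF cbilinear_tensor])
  show "clinear (swap12 :: 'a \<otimes> ('b \<otimes> 'c) \<Rightarrow> _)" "swap12 (a \<otimes> (b \<otimes> c)) = b \<otimes> (a \<otimes> c)"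
    unfolding swap12_def by (simp_all add: bil bil' lift_clinear)
qed

lemma tensor3_induct [case_names tensor add]:
  assumes "\<And>a b c. P (a \<otimes> (b \<otimes> c))" and "\<And>s t. P s \<Longrightarrow> P t \<Longrightarrow> P (s + t)"
  shows "P t"
proof (induction t rule: tensor_induct)
  case (tensor a t)
  show ?case
    by (induction t rule: tensor_induct) (simp_all add: assms cbilinearD[OF cbilinear_tensor])
qed (rule assms)

lemma tensor3_induct' [case_names tensor add]:
  assumes "\<And>a b c. P ((a \<otimes> b) \<otimes> c)" and "\<And>s t. P s \<Longrightarrow> P t \<Longrightarrow> P (s + t)"
  shows "P t"
proof (induction t rule: tensor_induct)
  case (tensor s c)
  show ?case
    by (induction s rule: tensor_induct) (simp_all add: assms cbilinearD[OF cbilinear_tensor])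
qed (rule assms)

lemma unassoc_assoc: "unassoc (assoc t) = t"
  by (induction t rule: tensor3_induct') (simp_all add: clinear_add[OF clinear_assoc] clinear_add[OF clinear_unassoc])

lemma assoc_unassoc: "assoc (unassoc t) = t"
  by (induction t rule: tensor3_induct) (simp_all add: clinear_add[OF clinear_assoc] clinear_add[OF clinear_unassoc])

lemma swap12_swap12: "swap12 (swap12 t) = t"
  by (induction t rule: tensor3_induct) (simp_all add: clinear_add[OF clinear_swap12])

lemma bij_assoc: "bij assoc"
  by (rule o_bij[of unassoc]) (simp_all add: fun_eq_iff unassoc_assoc assoc_unassoc)

lemma algebra_hom_assoc: "algebra_hom assoc"
proof -
  have "assoc (s * t) = assoc s * assoc t"
    for s t :: "('a::complex_algebra \<otimes> 'b::complex_algebra) \<otimes> 'c::complex_algebra"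
  proof (induction s rule: tensor3_induct')
    case (tensor a b c)
    show ?case
      by (induction t rule: tensor3_induct') (simp_all add: clinear_add[OF clinear_assoc] distrib_left)
  qed (simp add: clinear_add[OF clinear_assoc] distrib_right)
  then show ?thesis
    by (simp add: algebra_hom_def clinear_assoc)
qed

lemma bij_swap12: "bij swap12"
  by (rule o_bij[of swap12]) (simp_all add: fun_eq_iff swap12_swap12)

lemma algebra_hom_swap12: "algebra_hom swap12"
proof -
  have "swap12 (s * t) = swap12 s * swap12 t"
    for s t :: "'a::complex_algebra \<otimes> ('b::complex_algebra \<otimes> 'c::complex_algebra)"
  proof (induction s rule: tensor3_induct)
    case (tensor a b c)
    show ?case
      by (induction t rule: tensor3_induct) (simp_all add: clinear_add[OF clinear_swap12] distrib_left)
  qed (simp add: clinear_add[OF clinear_swap12] distrib_right)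
  then show ?thesis
    by (simp add: algebra_hom_def clinear_swap12)
qed


section \<open>Multipliers\<close>

text \<open>
  A multiplier \<open>m\<close> is a double centralizer: the pair of maps \<open>x \<mapsto> m x\<close> and \<open>x \<mapsto> x m\<close>.
\<close>

definition is_multiplier :: "('a::complex_algebra \<Rightarrow> 'a) \<times> ('a \<Rightarrow> 'a) \<Rightarrow> bool" where
  "is_multiplier m \<longleftrightarrow> (case m of (l, r) \<Rightarrow> clinear l \<and> clinear r \<and>
    (\<forall>x y. l (x * y) = l x * y) \<and> (\<forall>x y. r (x * y) = x * r y) \<and> (\<forall>x y. r x * y = x * l y))"

typedef (overloaded) 'a multiplier = "{m :: ('a::complex_algebra \<Rightarrow> 'a) \<times> ('a \<Rightarrow> 'a). is_multiplier m}"
  by (rule exI[of _ "(\<lambda>x. x, \<lambda>x. x)"]) (simp add: is_multiplier_def clinear_iff)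

setup_lifting type_definition_multiplier

lift_definition lact :: "'a::complex_algebra multiplier \<Rightarrow> 'a \<Rightarrow> 'a" (infixr \<open>\<rhd>\<close> 72)
  is "\<lambda>(l, r) x. l x" .

lift_definition ract :: "'a::complex_algebra \<Rightarrow> 'a multiplier \<Rightarrow> 'a" (infixl \<open>\<lhd>\<close> 72)
  is "\<lambda>x (l, r). r x" .

lemma multiplier_eqI:
  assumes "\<And>x. m \<rhd> x = n \<rhd> x" and "\<And>x. x \<lhd> m = x \<lhd> n"
  shows "m = n"
  using assms by transfer (auto simp: fun_eq_iff)

lemma clinear_lact: "clinear (\<lambda>x. m \<rhd> x)" and clinear_ract: "clinear (\<lambda>x. x \<lhd> m)"
  by (transfer; auto simp: is_multiplier_def)+

lemma lact_mult: "m \<rhd> (x * y) = (m \<rhd> x) * y"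
  and mult_ract: "(x * y) \<lhd> m = x * (y \<lhd> m)"
  and ract_mult_lact: "(x \<lhd> m) * y = x * (m \<rhd> y)"
  by (transfer; auto simp: is_multiplier_def)+

instantiation multiplier :: (complex_algebra) "{complex_algebra, monoid_mult}"
begin

lift_definition zero_multiplier :: "'a multiplier" is "(\<lambda>_. 0, \<lambda>_. 0)"
  by (simp add: is_multiplier_def clinear_iff)

lift_definition one_multiplier :: "'a multiplier" is "(\<lambda>x. x, \<lambda>x. x)"
  by (simp add: is_multiplier_def clinear_iff)

lift_definition plus_multiplier :: "'a multiplier \<Rightarrow> 'a multiplier \<Rightarrow> 'a multiplier"
  is "\<lambda>(l, r) (l', r'). (\<lambda>x. l x + l' x, \<lambda>x. r x + r' x)"
  by (auto simp: is_multiplier_def clinear_iff algebra_simps scaleC_add_right)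

lift_definition uminus_multiplier :: "'a multiplier \<Rightarrow> 'a multiplier"
  is "\<lambda>(l, r). (\<lambda>x. - l x, \<lambda>x. - r x)"
  by (auto simp: is_multiplier_def clinear_iff)

lift_definition minus_multiplier :: "'a multiplier \<Rightarrow> 'a multiplier \<Rightarrow> 'a multiplier"
  is "\<lambda>(l, r) (l', r'). (\<lambda>x. l x - l' x, \<lambda>x. r x - r' x)"
  by (auto simp: is_multiplier_def clinear_iff algebra_simps complex_vector.scale_right_diff_distrib)

lift_definition scaleC_multiplier :: "complex \<Rightarrow> 'a multiplier \<Rightarrow> 'a multiplier"
  is "\<lambda>c (l, r). (\<lambda>x. c *\<^sub>C l x, \<lambda>x. c *\<^sub>C r x)"
  by (auto simp: is_multiplier_def clinear_iff scaleC_add_right scaleC_scaleC mult.commute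
      mult_scaleC_left mult_scaleC_right)

lift_definition times_multiplier :: "'a multiplier \<Rightarrow> 'a multiplier \<Rightarrow> 'a multiplier"
  is "\<lambda>(l, r) (l', r'). (\<lambda>x. l (l' x), \<lambda>x. r' (r x))"
  by (auto simp: is_multiplier_def clinear_iff)

instance
proof
  fix m n k :: "'a multiplier" and a b :: complex
  show "m + n + k = m + (n + k)" "m + n = n + m" "0 + m = m" "- m + m = 0" "m - n = m + - n"
    by (transfer; auto simp: fun_eq_iff algebra_simps)+
  show "m * n * k = m * (n * k)" "1 * m = m" "m * 1 = m"
    by (transfer; auto simp: fun_eq_iff)+
  show "(m + n) * k = m * k + n * k" "m * (n + k) = m * n + m * k"
    by (transfer; auto simp: fun_eq_iff is_multiplier_def clinear_iff)+
  show "a *\<^sub>C (m + n) = a *\<^sub>C m + a *\<^sub>C n" "(a + b) *\<^sub>C m = a *\<^sub>C m + b *\<^sub>C m"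
    "a *\<^sub>C b *\<^sub>C m = (a * b) *\<^sub>C m" "1 *\<^sub>C m = m"
    by (transfer; auto simp: fun_eq_iff scaleC_add_right scaleC_add_left scaleC_scaleC scaleC_one)+
  show "a *\<^sub>C m * n = a *\<^sub>C (m * n)" "m * a *\<^sub>C n = a *\<^sub>C (m * n)"
    by (transfer; auto simp: fun_eq_iff is_multiplier_def clinear_iff)+
qed

end

lift_definition multiplier_of :: "'a::complex_algebra \<Rightarrow> 'a multiplier" (\<open>\<iota>\<close>)
  is "\<lambda>a. (\<lambda>x. a * x, \<lambda>x. x * a)"
  by (auto simp: is_multiplier_def mult.assoc clinear_mult_left clinear_mult_right)

lemma multiplier_action_simps [simp]:
  "1 \<rhd> x = x" "x \<lhd> 1 = x"
  "(m * n) \<rhd> x = m \<rhd> n \<rhd> x" "x \<lhd> (m * n) = x \<lhd> m \<lhd> n"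
  "\<iota> a \<rhd> x = a * x" "x \<lhd> \<iota> a = x * a"
  by (transfer; auto)+

lemma inj_multiplier_of: "inj (\<iota> :: 'a::nondegenerate_algebra \<Rightarrow> _)"
proof (rule injI)
  fix a b :: 'a assume "\<iota> a = \<iota> b"
  then have "\<iota> a \<rhd> x = \<iota> b \<rhd> x" for x by simp
  then have "(a - b) * x = 0" for x by (simp add: algebra_simps)
  then show "a = b" using nondegenerate_left[of "a - b"] by simp
qed

definition element_of :: "'a::nondegenerate_algebra multiplier \<Rightarrow> 'a" where
  "element_of = the_inv \<iota>"

lemma element_of_multiplier_of [simp]: "element_of (\<iota> a) = a"
  unfolding element_of_def by (rule the_inv_f_f[OF inj_multiplier_of])

lift_definition multiplier_tensor ::
    "'a::complex_algebra multiplier \<Rightarrow> 'b::complex_algebra multiplier \<Rightarrow> ('a \<otimes> 'b) multiplier" (infixr \<open>\<boxtimes>\<close> 71)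
  is "\<lambda>(l, r) (l', r'). (tensor_map l l', tensor_map r r')"
proof (clarsimp simp: is_multiplier_def)
  fix l r :: "'a \<Rightarrow> 'a" and l' r' :: "'b \<Rightarrow> 'b"
  assume m: "clinear l" "clinear r" "\<forall>x y. l (x * y) = l x * y" "\<forall>x y. r (x * y) = x * r y"
    "\<forall>x y. r x * y = x * l y"
  assume n: "clinear l'" "clinear r'" "\<forall>x y. l' (x * y) = l' x * y" "\<forall>x y. r' (x * y) = x * r' y"
    "\<forall>x y. r' x * y = x * l' y"
  note lin = clinear_tensor_map[OF m(1) n(1)] clinear_tensor_map[OF m(2) n(2)]
  note add = lin[THEN clinear_add]
  have 1: "tensor_map l l' (s * t) = tensor_map l l' s * t" for s t :: "'a \<otimes> 'b"
  proof (induction s rule: tensor_induct)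
    case (tensor a b)
    show ?case by (induction t rule: tensor_induct) (simp_all add: m n add distrib_left)
  qed (simp add: add distrib_right)
  have 2: "tensor_map r r' (s * t) = s * tensor_map r r' t" for s t :: "'a \<otimes> 'b"
  proof (induction s rule: tensor_induct)
    case (tensor a b)
    show ?case by (induction t rule: tensor_induct) (simp_all add: m n add distrib_left)
  qed (simp add: add distrib_right)
  have 3: "tensor_map r r' s * t = s * tensor_map l l' t" for s t :: "'a \<otimes> 'b"
  proof (induction s rule: tensor_induct)
    case (tensor a b)
    show ?case by (induction t rule: tensor_induct) (simp_all add: m n add distrib_left)
  qed (simp add: add distrib_right)
  show "clinear (tensor_map l l') \<and> clinear (tensor_map r r') \<and>
      (\<forall>x y. tensor_map l l' (x * y) = tensor_map l l' x * y) \<and>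
      (\<forall>x y. tensor_map r r' (x * y) = x * tensor_map r r' y) \<and>
      (\<forall>x y. tensor_map r r' x * y = x * tensor_map l l' y)"
    using lin 1 2 3 by simp
qed

lemma multiplier_tensor_act [simp]:
  "(m \<boxtimes> n) \<rhd> (a \<otimes> b) = (m \<rhd> a) \<otimes> (n \<rhd> b)"
  "(a \<otimes> b) \<lhd> (m \<boxtimes> n) = (a \<lhd> m) \<otimes> (b \<lhd> n)"
proof -
  have lin: "clinear (fst (Rep_multiplier k))" "clinear (snd (Rep_multiplier k))"
    for k :: "'x::complex_algebra multiplier"
    using Rep_multiplier[of k] by (simp_all add: is_multiplier_def case_prod_unfold)
  show "(m \<boxtimes> n) \<rhd> (a \<otimes> b) = (m \<rhd> a) \<otimes> (n \<rhd> b)"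
    and "(a \<otimes> b) \<lhd> (m \<boxtimes> n) = (a \<lhd> m) \<otimes> (b \<lhd> n)"
    by (simp_all add: lact.rep_eq ract.rep_eq multiplier_tensor.rep_eq case_prod_unfold lin)
qed

lemma multiplier_of_tensor:
  fixes a :: "'a::complex_algebra" and b :: "'b::complex_algebra"
  shows "\<iota> (a \<otimes> b) = \<iota> a \<boxtimes> \<iota> b"
proof (rule multiplier_eqI)
  fix x :: "'a \<otimes> 'b"
  show "\<iota> (a \<otimes> b) \<rhd> x = (\<iota> a \<boxtimes> \<iota> b) \<rhd> x"
    by (rule tensor_ext[OF clinear_lact clinear_lact]) simp
  show "x \<lhd> \<iota> (a \<otimes> b) = x \<lhd> (\<iota> a \<boxtimes> \<iota> b)"
    by (rule tensor_ext[OF clinear_ract clinear_ract]) simp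
qed

text \<open>The isomorphism of multiplier algebras induced by an isomorphism of algebras.\<close>

definition transport :: "('a::complex_algebra \<Rightarrow> 'b::complex_algebra) \<Rightarrow> 'a multiplier \<Rightarrow> 'b multiplier" where
  "transport f m = Abs_multiplier (\<lambda>y. f (m \<rhd> inv f y), \<lambda>y. f (inv f y \<lhd> m))"

lemma transport_act:
  assumes "algebra_hom f" "bij f"
  shows "transport f m \<rhd> f x = f (m \<rhd> x)" and "f x \<lhd> transport f m = f (x \<lhd> m)"
proof -
  have lin: "clinear f" and mult: "f (x * y) = f x * f y" for x y
    using assms(1) by (auto simp: algebra_hom_def)
  have inv [simp]: "inv f (f x) = x" "f (inv f y) = y" for x y
    using assms(2) by (simp_all add: bij_is_inj bij_is_surj surj_f_inv_f)
  have inv_eq: "inv f y = x" if "f x = y" for x y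
    using that inv(1) by blast
  have inv_add: "inv f (y + y') = inv f y + inv f y'" for y y'
    by (rule inv_eq) (simp add: clinear_add[OF lin])
  have inv_scaleC: "inv f (c *\<^sub>C y) = c *\<^sub>C inv f y" for c y
    by (rule inv_eq) (simp add: clinear_scaleC[OF lin])
  have inv_mult: "inv f (y * y') = inv f y * inv f y'" for y y'
    by (rule inv_eq) (simp add: mult)
  have "is_multiplier (\<lambda>y. f (m \<rhd> inv f y), \<lambda>y. f (inv f y \<lhd> m))"
    unfolding is_multiplier_def
  proof (clarsimp, intro conjI allI)
    fix x y
    show "f (m \<rhd> inv f (x * y)) = f (m \<rhd> inv f x) * y"
      using mult[of "m \<rhd> inv f x" "inv f y"] by (simp add: inv_mult lact_mult)
    show "f (inv f (x * y) \<lhd> m) = x * f (inv f y \<lhd> m)"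
      using mult[of "inv f x" "inv f y \<lhd> m"] by (simp add: inv_mult mult_ract)
    show "f (inv f x \<lhd> m) * y = x * f (m \<rhd> inv f y)"
      using mult[of "inv f x \<lhd> m" "inv f y"] mult[of "inv f x" "m \<rhd> inv f y"]
      by (simp add: ract_mult_lact)
  qed (auto simp: clinear_iff inv_add inv_scaleC clinear_add[OF lin] clinear_scaleC[OF lin]
      clinear_add[OF clinear_lact] clinear_scaleC[OF clinear_lact]
      clinear_add[OF clinear_ract] clinear_scaleC[OF clinear_ract])
  then show "transport f m \<rhd> f x = f (m \<rhd> x)" "f x \<lhd> transport f m = f (x \<lhd> m)"
    by (simp_all add: transport_def lact.rep_eq ract.rep_eq Abs_multiplier_inverse)
qed

text \<open>
  The extension to multipliers of a homomorphism \<open>\<phi> : B \<rightarrow> M(C)\<close> with \<open>\<phi>(B)C = e C\<close> and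
  \<open>C\<phi>(B) = C e\<close> for an idempotent \<open>e \<in> M(C)\<close>: the unique homomorphism on \<open>M(B)\<close> that extends
  \<open>\<phi>\<close> and sends \<open>1\<close> to \<open>e\<close>.
\<close>

definition multiplier_extension ::
    "('b::complex_algebra \<Rightarrow> 'c::complex_algebra multiplier) \<Rightarrow> 'c multiplier \<Rightarrow> 'b multiplier \<Rightarrow> 'c multiplier" where
  "multiplier_extension \<phi> e = (THE \<psi>. algebra_hom \<psi> \<and> (\<forall>b. \<psi> (\<iota> b) = \<phi> b) \<and> \<psi> 1 = e)"


section \<open>Coproducts\<close>

text \<open>
  \<open>T1\<close> and \<open>T2\<close> take values in \<open>A \<otimes> A\<close> because \<open>\<Delta>(a)(1 \<otimes> b)\<close> and \<open>(a \<otimes> 1)\<Delta>(b)\<close> are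
  required to lie there.
\<close>

definition T1 :: "('a::nondegenerate_algebra \<Rightarrow> ('a \<otimes> 'a) multiplier) \<Rightarrow> 'a \<otimes> 'a \<Rightarrow> 'a \<otimes> 'a" where
  "T1 \<Delta> = lift (\<lambda>a b. element_of (\<Delta> a * (1 \<boxtimes> \<iota> b)))"

definition T2 :: "('a::nondegenerate_algebra \<Rightarrow> ('a \<otimes> 'a) multiplier) \<Rightarrow> 'a \<otimes> 'a \<Rightarrow> 'a \<otimes> 'a" where
  "T2 \<Delta> = lift (\<lambda>a b. element_of ((\<iota> a \<boxtimes> 1) * \<Delta> b))"

definition Delta_id ::
    "('a::nondegenerate_algebra \<Rightarrow> ('a \<otimes> 'a) multiplier) \<Rightarrow> 'a \<otimes> 'a \<Rightarrow> ('a \<otimes> ('a \<otimes> 'a)) multiplier" where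
  "Delta_id \<Delta> x = transport assoc (lift (\<lambda>a b. \<Delta> a \<boxtimes> \<iota> b) x)"

definition id_Delta ::
    "('a::nondegenerate_algebra \<Rightarrow> ('a \<otimes> 'a) multiplier) \<Rightarrow> 'a \<otimes> 'a \<Rightarrow> ('a \<otimes> ('a \<otimes> 'a)) multiplier" where
  "id_Delta \<Delta> = lift (\<lambda>a b. \<iota> a \<boxtimes> \<Delta> b)"

definition Delta13 ::
    "('a::nondegenerate_algebra \<Rightarrow> ('a \<otimes> 'a) multiplier) \<Rightarrow> 'a \<Rightarrow> ('a \<otimes> ('a \<otimes> 'a)) multiplier" where
  "Delta13 \<Delta> a = transport swap12 (1 \<boxtimes> \<Delta> a)"

locale coproduct =
  fixes \<Delta> :: "'a::nondegenerate_algebra \<Rightarrow> ('a \<otimes> 'a) multiplier"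
  assumes hom: "algebra_hom \<Delta>"
    and T1_in: "\<Delta> a * (1 \<boxtimes> \<iota> b) \<in> range \<iota>"
    and T2_in: "(\<iota> a \<boxtimes> 1) * \<Delta> b \<in> range \<iota>"
    and coassociative:
      "(\<iota> a \<boxtimes> (1 \<boxtimes> 1)) * Delta_id \<Delta> (T1 \<Delta> (b \<otimes> c)) =
        id_Delta \<Delta> (T2 \<Delta> (a \<otimes> b)) * (1 \<boxtimes> (1 \<boxtimes> \<iota> c))"

definition subspace_tensor ::
    "'a::complex_vector set \<Rightarrow> 'b::complex_vector set \<Rightarrow> ('a \<otimes> 'b) set" where
  "subspace_tensor V W = complex_vector.span {v \<otimes> w | v w. v \<in> V \<and> w \<in> W}"

definition left_leg :: "('a::nondegenerate_algebra \<Rightarrow> ('a \<otimes> 'a) multiplier) \<Rightarrow> 'a set" where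
  "left_leg \<Delta> = \<Inter>{V. complex_vector.subspace V \<and> (\<forall>a b. T1 \<Delta> (a \<otimes> b) \<in> subspace_tensor V UNIV)}"

definition right_leg :: "('a::nondegenerate_algebra \<Rightarrow> ('a \<otimes> 'a) multiplier) \<Rightarrow> 'a set" where
  "right_leg \<Delta> = \<Inter>{W. complex_vector.subspace W \<and> (\<forall>a b. T2 \<Delta> (a \<otimes> b) \<in> subspace_tensor UNIV W)}"

definition full :: "('a::nondegenerate_algebra \<Rightarrow> ('a \<otimes> 'a) multiplier) \<Rightarrow> bool" where
  "full \<Delta> \<longleftrightarrow> left_leg \<Delta> = UNIV \<and> right_leg \<Delta> = UNIV"

definition counit ::
    "('a::nondegenerate_algebra \<Rightarrow> ('a \<otimes> 'a) multiplier) \<Rightarrow> ('a \<Rightarrow> complex) \<Rightarrow> bool" where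
  "counit \<Delta> \<epsilon> \<longleftrightarrow> clinear \<epsilon> \<and>
    (\<forall>a b. lift (\<lambda>x y. \<epsilon> x *\<^sub>C y) (T1 \<Delta> (a \<otimes> b)) = a * b) \<and>
    (\<forall>a c. lift (\<lambda>x y. \<epsilon> y *\<^sub>C x) (T2 \<Delta> (c \<otimes> a)) = c * a)"


section \<open>Weak multiplier Hopf algebras\<close>

text \<open>
  The data \<open>E\<close>, \<open>G1\<close>, \<open>G2\<close> and, below, the antipode \<open>S\<close> are uniquely determined by \<open>\<Delta>\<close>; they are
  parameters of the locales instead of being existentially quantified.
\<close>

locale weak_multiplier_hopf_algebra = coproduct \<Delta>
  for \<Delta> :: "'a::nondegenerate_algebra \<Rightarrow> ('a \<otimes> 'a) multiplier" +
  fixes \<epsilon> :: "'a \<Rightarrow> complex"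
    and E :: "('a \<otimes> 'a) multiplier"
    and G1 G2 :: "'a \<otimes> 'a \<Rightarrow> 'a \<otimes> 'a"
  assumes idempotent_algebra: "complex_vector.span {a * b | a b :: 'a. True} = UNIV"
    and full: "full \<Delta>"
    and counit: "counit \<Delta> \<epsilon>"
    and E_idempotent: "E * E = E"
    and range_T1: "range (T1 \<Delta>) = range (\<lambda>x. E \<rhd> x)"
    and range_T2: "range (T2 \<Delta>) = range (\<lambda>x. x \<lhd> E)"
    and id_Delta_E:
      "multiplier_extension (id_Delta \<Delta>) (1 \<boxtimes> E) E = transport assoc (E \<boxtimes> 1) * (1 \<boxtimes> E)"
    and E_commute: "transport assoc (E \<boxtimes> 1) * (1 \<boxtimes> E) = (1 \<boxtimes> E) * transport assoc (E \<boxtimes> 1)"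
    and linear_G1: "clinear G1"
    and linear_G2: "clinear G2"
    and G1: "\<iota> (assoc (tensor_map G1 id (unassoc (element_of (Delta13 \<Delta> a * (1 \<boxtimes> (\<iota> b \<boxtimes> \<iota> c))))))) =
        Delta13 \<Delta> a * (1 \<boxtimes> E) * (1 \<boxtimes> (\<iota> b \<boxtimes> \<iota> c))"
    and G2: "\<iota> (tensor_map id G2 (element_of ((\<iota> a \<boxtimes> (\<iota> b \<boxtimes> 1)) * Delta13 \<Delta> c))) =
        (\<iota> a \<boxtimes> (\<iota> b \<boxtimes> 1)) * transport assoc (E \<boxtimes> 1) * Delta13 \<Delta> c"
    and kernel_T1: "{x. T1 \<Delta> x = 0} = range (\<lambda>x. x - G1 x)"
    and kernel_T2: "{x. T2 \<Delta> x = 0} = range (\<lambda>x. x - G2 x)"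

definition mult_id_S :: "('a::complex_algebra \<Rightarrow> 'a multiplier) \<Rightarrow> 'a \<otimes> 'a \<Rightarrow> 'a" where
  "mult_id_S S = lift (\<lambda>a b. a \<lhd> S b)"

definition mult_S_id :: "('a::complex_algebra \<Rightarrow> 'a multiplier) \<Rightarrow> 'a \<otimes> 'a \<Rightarrow> 'a" where
  "mult_S_id S = lift (\<lambda>a b. S a \<rhd> b)"

text \<open>
  Sweedler expressions get their meaning by covering: multiply with elements of \<open>A\<close> on the legs
  that are not covered yet, and use \<open>T1 (a \<otimes> d) = \<Sum> a\<^sub>1 \<otimes> a\<^sub>2 d\<close> and \<open>T2 (c \<otimes> a) = \<Sum> c a\<^sub>1 \<otimes> a\<^sub>2\<close>.
  By non-degeneracy each of the following predicates holds for at most one \<open>x\<close>.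
\<close>

text \<open>\<open>x = \<Sum> a\<^sub>1 \<otimes> a\<^sub>2 S(a\<^sub>3) b\<close>, covered by \<open>c \<otimes> d\<close> on the left\<close>

definition sweedler_id_idS ::
    "('a::nondegenerate_algebra \<Rightarrow> ('a \<otimes> 'a) multiplier) \<Rightarrow> ('a \<Rightarrow> 'a multiplier) \<Rightarrow>
      'a \<Rightarrow> 'a \<Rightarrow> 'a \<otimes> 'a \<Rightarrow> bool" where
  "sweedler_id_idS \<Delta> S a b x \<longleftrightarrow> (\<forall>c d.
    (c \<otimes> d) * x = lift (\<lambda>p q. p \<otimes> (mult_id_S S (T2 \<Delta> (d \<otimes> q)) * b)) (T2 \<Delta> (c \<otimes> a)))"

text \<open>\<open>x = \<Sum> a S(b\<^sub>1) b\<^sub>2 \<otimes> b\<^sub>3\<close>, covered by \<open>c \<otimes> d\<close> on the right\<close>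

definition sweedler_Sid_id ::
    "('a::nondegenerate_algebra \<Rightarrow> ('a \<otimes> 'a) multiplier) \<Rightarrow> ('a \<Rightarrow> 'a multiplier) \<Rightarrow>
      'a \<Rightarrow> 'a \<Rightarrow> 'a \<otimes> 'a \<Rightarrow> bool" where
  "sweedler_Sid_id \<Delta> S a b x \<longleftrightarrow> (\<forall>c d.
    x * (c \<otimes> d) = lift (\<lambda>p q. (a * mult_S_id S (T1 \<Delta> (p \<otimes> c))) \<otimes> q) (T1 \<Delta> (b \<otimes> d)))"

text \<open>\<open>x = \<Sum> a\<^sub>1 \<otimes> S(a\<^sub>2) a\<^sub>3 b\<close>, covered by \<open>c \<otimes> 1\<close> on the left\<close>

definition sweedler_id_Sid ::
    "('a::nondegenerate_algebra \<Rightarrow> ('a \<otimes> 'a) multiplier) \<Rightarrow> ('a \<Rightarrow> 'a multiplier) \<Rightarrow>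
      'a \<Rightarrow> 'a \<Rightarrow> 'a \<otimes> 'a \<Rightarrow> bool" where
  "sweedler_id_Sid \<Delta> S a b x \<longleftrightarrow> (\<forall>c.
    (\<iota> c \<boxtimes> 1) \<rhd> x = lift (\<lambda>p q. p \<otimes> mult_S_id S (T1 \<Delta> (q \<otimes> b))) (T2 \<Delta> (c \<otimes> a)))"

text \<open>\<open>x = \<Sum> a b\<^sub>1 S(b\<^sub>2) \<otimes> b\<^sub>3\<close>, covered by \<open>1 \<otimes> c\<close> on the right\<close>

definition sweedler_idS_id ::
    "('a::nondegenerate_algebra \<Rightarrow> ('a \<otimes> 'a) multiplier) \<Rightarrow> ('a \<Rightarrow> 'a multiplier) \<Rightarrow>
      'a \<Rightarrow> 'a \<Rightarrow> 'a \<otimes> 'a \<Rightarrow> bool" where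
  "sweedler_idS_id \<Delta> S a b x \<longleftrightarrow> (\<forall>c.
    x \<lhd> (1 \<boxtimes> \<iota> c) = lift (\<lambda>p q. mult_id_S S (T2 \<Delta> (a \<otimes> p)) \<otimes> q) (T1 \<Delta> (b \<otimes> c)))"

text \<open>
  The last condition is \<open>\<Sum> S(a\<^sub>1) a\<^sub>2 S(a\<^sub>3) b = S(a) b\<close> for all \<open>b\<close>, where
  \<open>\<Sum> a\<^sub>1 \<otimes> a\<^sub>2 S(a\<^sub>3) b\<close> is the element \<open>x\<close> of \<open>A \<otimes> A\<close> given by \<open>sweedler_id_idS\<close>.
\<close>

definition antipode ::
    "('a::nondegenerate_algebra \<Rightarrow> ('a \<otimes> 'a) multiplier) \<Rightarrow> ('a \<otimes> 'a) multiplier \<Rightarrow>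
      ('a \<otimes> 'a \<Rightarrow> 'a \<otimes> 'a) \<Rightarrow> ('a \<otimes> 'a \<Rightarrow> 'a \<otimes> 'a) \<Rightarrow> ('a \<Rightarrow> 'a multiplier) \<Rightarrow> bool" where
  "antipode \<Delta> E G1 G2 S \<longleftrightarrow>
    clinear S \<and> (\<forall>a b. S (a * b) = S b * S a) \<and>
    complex_vector.span {S a \<rhd> b | a b. True} = UNIV \<and>
    complex_vector.span {b \<lhd> S a | a b. True} = UNIV \<and>
    (\<forall>a b. sweedler_id_idS \<Delta> S a b (E \<rhd> (a \<otimes> b))) \<and>
    (\<forall>a b. sweedler_Sid_id \<Delta> S a b ((a \<otimes> b) \<lhd> E)) \<and>
    (\<forall>a b. sweedler_id_Sid \<Delta> S a b (G1 (a \<otimes> b))) \<and>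
    (\<forall>a b. sweedler_idS_id \<Delta> S a b (G2 (a \<otimes> b))) \<and>
    (\<forall>a b x. sweedler_id_idS \<Delta> S a b x \<longrightarrow> mult_S_id S x = S a \<rhd> b)"

locale regular_weak_multiplier_hopf_algebra = weak_multiplier_hopf_algebra \<Delta> \<epsilon> E G1 G2
  for \<Delta> :: "'a::nondegenerate_algebra \<Rightarrow> ('a \<otimes> 'a) multiplier" and \<epsilon> E G1 G2 +
  fixes S :: "'a \<Rightarrow> 'a multiplier"
  assumes antipode: "antipode \<Delta> E G1 G2 S"
    and regular: "bij_betw S UNIV (range \<iota>)"

text \<open>\<open>\<epsilon>\<^sub>t(a) = \<Sum> a\<^sub>1 S(a\<^sub>2)\<close> is the multiplier \<open>m\<close> with \<open>c m = \<Sum> c a\<^sub>1 S(a\<^sub>2)\<close> for all \<open>c\<close>.\<close>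

definition epsilon_t ::
    "('a::nondegenerate_algebra \<Rightarrow> ('a \<otimes> 'a) multiplier) \<Rightarrow> ('a \<Rightarrow> 'a multiplier) \<Rightarrow> 'a \<Rightarrow> 'a multiplier" where
  "epsilon_t \<Delta> S a = (THE m. \<forall>c. c \<lhd> m = mult_id_S S (T2 \<Delta> (c \<otimes> a)))"

definition left_cointegral ::
    "('a::nondegenerate_algebra \<Rightarrow> ('a \<otimes> 'a) multiplier) \<Rightarrow> ('a \<Rightarrow> 'a multiplier) \<Rightarrow> 'a multiplier \<Rightarrow> bool" where
  "left_cointegral \<Delta> S h \<longleftrightarrow> h \<noteq> 0 \<and> (\<forall>a. \<iota> a * h = epsilon_t \<Delta> S a * h)"

end

theory Submission
  imports Defs
begin

text \<open>
  Let \<open>h \<noteq> 0\<close> be annihilated from the left by \<open>Ker \<epsilon>\<close>, fix \<open>e\<close> with \<open>\<epsilon>(e) = 1\<close> and put \<open>k = e h\<close>.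
  Since \<open>a - \<epsilon>(a) e\<close> lies in \<open>Ker \<epsilon>\<close>, we have \<open>a h = \<epsilon>(a) k\<close>, and non-degeneracy gives \<open>k \<noteq> 0\<close>.
  Evaluating \<open>a b h\<close> in two ways gives \<open>\<epsilon>(ab) k = \<epsilon>(b) a k\<close>. With \<open>b = e\<close> this says that
  \<open>a k = \<chi>(a) k\<close> for the functional \<open>\<chi>(a) = \<epsilon>(a e)\<close>, and then that \<open>\<epsilon>(ab) = \<chi>(a) \<epsilon>(b)\<close>.

  Such a factorisation of the counit forces \<open>\<chi> = \<epsilon>\<close>. Applying \<open>\<epsilon> \<otimes> id\<close> to
  \<open>\<Delta>(ab)(1 \<otimes> c) = \<Delta>(a) \<Delta>(b)(1 \<otimes> c)\<close> shows \<open>(\<chi> \<otimes> id)(\<Delta>(a)(1 \<otimes> bc)) = abc\<close>, so \<open>\<chi>\<close> satisfies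
  the counit equation on the left leg of \<open>\<Delta>\<close>, and fullness determines a functional with this
  property (\<open>factor_of_counit_eq\<close>). Hence \<open>\<epsilon>\<close> is a homomorphism and \<open>a k = \<epsilon>(a) k\<close>.

  If \<open>\<epsilon>\<close> is a homomorphism, then \<open>\<epsilon>\<^sub>t(a) = \<epsilon>(a) 1\<close> (\<open>epsilon_t_eq_counit\<close>): the homomorphism
  \<open>\<epsilon> \<otimes> id\<close> does not see \<open>E\<close>, because \<open>E\<close> acts as the identity on the elements \<open>\<Delta>(a)(1 \<otimes> b)\<close>,
  which \<open>\<epsilon> \<otimes> id\<close> maps to \<open>ab\<close>; so applying \<open>\<epsilon> \<otimes> id\<close> to \<open>E(a \<otimes> b) = \<Sum> a\<^sub>1 \<otimes> a\<^sub>2 S(a\<^sub>3) b\<close> yields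
  \<open>\<epsilon>(a) b = \<Sum> a\<^sub>1 S(a\<^sub>2) b\<close>. Therefore \<open>a k = \<epsilon>\<^sub>t(a) k\<close>, and \<open>k\<close> is a left cointegral.
\<close>


section \<open>Slice maps\<close>

definition slice :: "('a::complex_vector \<Rightarrow> complex) \<Rightarrow> 'a \<otimes> 'b::complex_vector \<Rightarrow> 'b" where
  "slice \<phi> = lift (\<lambda>x y. \<phi> x *\<^sub>C y)"

lemma cbilinear_slice: "clinear \<phi> \<Longrightarrow> cbilinear (\<lambda>x y. \<phi> x *\<^sub>C (y::'b::complex_vector))"
  by (rule cbilinearI)
    (simp_all add: clinear_add clinear_scaleC scaleC_add_left scaleC_add_right scaleC_scaleC
      scaleC_complex_def mult.commute)

lemma clinear_slice: "clinear \<phi> \<Longrightarrow> clinear (slice \<phi>)"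
  by (simp add: slice_def lift_clinear cbilinear_slice)

lemma slice_tensor [simp]: "clinear \<phi> \<Longrightarrow> slice \<phi> (a \<otimes> b) = \<phi> a *\<^sub>C b"
  by (simp add: slice_def cbilinear_slice)

lemma slice_right_factor:
  fixes t :: "'a::complex_algebra \<otimes> 'b::complex_algebra"
  assumes \<phi>: "clinear \<phi>"
  shows "slice \<phi> (t \<lhd> (1 \<boxtimes> \<iota> b)) = slice \<phi> t * b"
  by (induction t rule: tensor_induct)
    (simp_all add: \<phi> clinear_add[OF clinear_slice[OF \<phi>]] clinear_add[OF clinear_ract]
      mult_scaleC_left distrib_right)

lemma slice_mult:
  fixes s t :: "'a::complex_algebra \<otimes> 'b::complex_algebra"
  assumes \<phi>: "clinear \<phi>" and mult: "\<And>x y. \<phi> (x * y) = \<phi> x * \<phi> y"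
  shows "slice \<phi> (s * t) = slice \<phi> s * slice \<phi> t"
proof (induction s rule: tensor_induct)
  case (tensor a b)
  show ?case
    by (induction t rule: tensor_induct)
      (simp_all add: \<phi> mult clinear_add[OF clinear_slice[OF \<phi>]] distrib_left
        mult_scaleC_left mult_scaleC_right scaleC_scaleC)
qed (simp add: clinear_add[OF clinear_slice[OF \<phi>]] distrib_right)

lemma subspace_kernel: "clinear \<phi> \<Longrightarrow> complex_vector.subspace {v. \<phi> v = 0}"
  by (simp add: complex_vector.subspace_def clinear_zero clinear_add clinear_scaleC)

text \<open>
  If \<open>\<phi>(v) = 1\<close>, then \<open>a \<mapsto> a - \<phi>(a) v\<close> projects onto \<open>Ker \<phi>\<close>, so modulo \<open>Ker \<phi> \<otimes> B\<close> every tensor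
  \<open>t\<close> equals \<open>v \<otimes> (\<phi> \<otimes> id)(t)\<close>.
\<close>

lemma slice_eq_0_imp_in_kernel_tensor:
  fixes t :: "'a::complex_vector \<otimes> 'b::complex_vector"
  assumes \<phi>: "clinear \<phi>" and v: "\<phi> v = 1" and zero: "slice \<phi> t = 0"
  shows "t \<in> subspace_tensor {v. \<phi> v = 0} UNIV"
proof -
  note bil = cbilinearD[OF cbilinear_tensor]
  have "t - v \<otimes> slice \<phi> t \<in> subspace_tensor {v. \<phi> v = 0} UNIV"
  proof (induction t rule: tensor_induct)
    case (tensor a b)
    have "a \<otimes> b = (a - \<phi> a *\<^sub>C v) \<otimes> b + (\<phi> a *\<^sub>C v) \<otimes> b"
      using bil(1)[of "a - \<phi> a *\<^sub>C v" "\<phi> a *\<^sub>C v" b] by simp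
    moreover have "v \<otimes> slice \<phi> (a \<otimes> b) = (\<phi> a *\<^sub>C v) \<otimes> b"
      by (simp add: \<phi> bil)
    ultimately have "a \<otimes> b - v \<otimes> slice \<phi> (a \<otimes> b) = (a - \<phi> a *\<^sub>C v) \<otimes> b"
      by (metis add_diff_cancel_right')
    moreover have "\<phi> (a - \<phi> a *\<^sub>C v) = 0"
      using clinear_add[OF \<phi>, of "a - \<phi> a *\<^sub>C v" "\<phi> a *\<^sub>C v"]
      by (simp add: clinear_scaleC[OF \<phi>] v scaleC_complex_def)
    ultimately show ?case
      unfolding subspace_tensor_def by (auto intro!: complex_vector.span_base)
  next
    case (add s t)
    have "s + t - v \<otimes> slice \<phi> (s + t) = (s - v \<otimes> slice \<phi> s) + (t - v \<otimes> slice \<phi> t)"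
      by (simp add: clinear_add[OF clinear_slice[OF \<phi>]] bil)
    then show ?case
      using add unfolding subspace_tensor_def by (simp only: complex_vector.span_add)
  qed
  moreover have "v \<otimes> (0 :: 'b) = 0"
    using bil(4)[of v 0 0] by simp
  ultimately show ?thesis
    using zero by simp
qed


section \<open>The canonical maps of a coproduct\<close>

lemma clinear_multiplier_of: "clinear (\<iota> :: 'a::complex_algebra \<Rightarrow> _)"
  by (rule clinearI; transfer)
    (simp_all add: fun_eq_iff algebra_simps mult_scaleC_left mult_scaleC_right)

lemma multiplier_of_mult: "\<iota> (a * b) = \<iota> a * \<iota> b"
  by transfer (simp add: fun_eq_iff mult.assoc)

lemma lact_add: "(m + n) \<rhd> x = (m \<rhd> x) + (n \<rhd> x)" and ract_add: "x \<lhd> (m + n) = (x \<lhd> m) + (x \<lhd> n)"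
  and lact_scaleC: "(c *\<^sub>C m) \<rhd> x = c *\<^sub>C (m \<rhd> x)" and ract_scaleC: "x \<lhd> (c *\<^sub>C m) = c *\<^sub>C (x \<lhd> m)"
  by (transfer; auto)+

lemma multiplier_tensor_eqI:
  fixes m n :: "('a::complex_algebra \<otimes> 'b::complex_algebra) multiplier"
  assumes "\<And>a b. m \<rhd> (a \<otimes> b) = n \<rhd> (a \<otimes> b)" and "\<And>a b. (a \<otimes> b) \<lhd> m = (a \<otimes> b) \<lhd> n"
  shows "m = n"
  by (rule multiplier_eqI)
    (rule tensor_ext[OF clinear_lact clinear_lact assms(1)]
      tensor_ext[OF clinear_ract clinear_ract assms(2)])+

lemma cbilinear_multiplier_tensor:
  "cbilinear ((\<boxtimes>) :: 'a::complex_algebra multiplier \<Rightarrow> 'b::complex_algebra multiplier \<Rightarrow> _)"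
  by (rule cbilinearI; rule multiplier_tensor_eqI)
    (simp_all add: lact_add ract_add lact_scaleC ract_scaleC cbilinearD[OF cbilinear_tensor])

lemma multiplier_of_lact: "m * \<iota> x = \<iota> (m \<rhd> x)" and multiplier_of_ract: "\<iota> x * m = \<iota> (x \<lhd> m)"
  by (rule multiplier_eqI; simp add: lact_mult mult_ract ract_mult_lact)+

lemma cbilinear_element_of:
  assumes g: "cbilinear g" and range: "\<And>a b. g a b \<in> range \<iota>"
  shows "cbilinear (\<lambda>a b. element_of (g a b :: 'c::nondegenerate_algebra multiplier))"
proof -
  have \<iota>: "\<iota> (element_of (g a b)) = g a b" for a b
    using range[of a b] by auto
  show ?thesis
    by (rule cbilinearI; rule injD[OF inj_multiplier_of];
        simp only: \<iota> clinear_add[OF clinear_multiplier_of] clinear_scaleC[OF clinear_multiplier_of];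
        rule cbilinearD[OF g])
qed

context coproduct
begin

lemma clinear_Delta: "clinear \<Delta>" and Delta_mult: "\<Delta> (a * b) = \<Delta> a * \<Delta> b"
  using hom by (simp_all add: algebra_hom_def)

lemma cbilinear_T1: "cbilinear (\<lambda>a b. element_of (\<Delta> a * (1 \<boxtimes> \<iota> b)))"
proof (rule cbilinear_element_of)
  show "cbilinear (\<lambda>a b. \<Delta> a * (1 \<boxtimes> \<iota> b))"
    by (rule cbilinearI)
      (simp_all add: clinear_add[OF clinear_Delta] clinear_scaleC[OF clinear_Delta]
        clinear_add[OF clinear_multiplier_of] clinear_scaleC[OF clinear_multiplier_of]
        cbilinearD[OF cbilinear_multiplier_tensor] mult_scaleC_left mult_scaleC_right
        distrib_left distrib_right)
qed (rule T1_in)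

lemma cbilinear_T2: "cbilinear (\<lambda>a b. element_of ((\<iota> a \<boxtimes> 1) * \<Delta> b))"
proof (rule cbilinear_element_of)
  show "cbilinear (\<lambda>a b. (\<iota> a \<boxtimes> 1) * \<Delta> b)"
    by (rule cbilinearI)
      (simp_all add: clinear_add[OF clinear_Delta] clinear_scaleC[OF clinear_Delta]
        clinear_add[OF clinear_multiplier_of] clinear_scaleC[OF clinear_multiplier_of]
        cbilinearD[OF cbilinear_multiplier_tensor] mult_scaleC_left mult_scaleC_right
        distrib_left distrib_right)
qed (rule T2_in)

lemma clinear_T1: "clinear (T1 \<Delta>)" and clinear_T2: "clinear (T2 \<Delta>)"
  by (simp_all add: T1_def T2_def lift_clinear cbilinear_T1 cbilinear_T2)

lemma multiplier_of_T1: "\<iota> (T1 \<Delta> (a \<otimes> b)) = \<Delta> a * (1 \<boxtimes> \<iota> b)"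
  using T1_in[of a b] by (auto simp: T1_def cbilinear_T1)

lemma multiplier_of_T2: "\<iota> (T2 \<Delta> (a \<otimes> b)) = (\<iota> a \<boxtimes> 1) * \<Delta> b"
  using T2_in[of a b] by (auto simp: T2_def cbilinear_T2)

lemma T2_T1: "T2 \<Delta> (c \<otimes> a) \<lhd> (1 \<boxtimes> \<iota> b) = (\<iota> c \<boxtimes> 1) \<rhd> T1 \<Delta> (a \<otimes> b)"
  by (rule injD[OF inj_multiplier_of])
    (simp add: multiplier_of_lact[symmetric] multiplier_of_ract[symmetric] multiplier_of_T1
      multiplier_of_T2 mult.assoc)

lemma T1_mult_left: "T1 \<Delta> ((a * b) \<otimes> c) = \<Delta> a \<rhd> T1 \<Delta> (b \<otimes> c)"
  by (rule injD[OF inj_multiplier_of])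
    (simp add: multiplier_of_lact[symmetric] multiplier_of_T1 Delta_mult mult.assoc)

text \<open>
  Since \<open>1 \<otimes> q\<close> and \<open>p \<otimes> 1\<close> commute, the action of \<open>\<Delta>(a)\<close> on all of \<open>A \<otimes> A\<close> is recovered from
  \<open>\<Delta>(a)(1 \<otimes> q) \<in> A \<otimes> A\<close>.
\<close>

lemma Delta_lact_tensor: "\<Delta> a \<rhd> (p \<otimes> q) = T1 \<Delta> (a \<otimes> q) \<lhd> (\<iota> p \<boxtimes> 1)"
proof (rule injD[OF inj_multiplier_of])
  have "(1 \<boxtimes> \<iota> q) * (\<iota> p \<boxtimes> 1) = \<iota> p \<boxtimes> \<iota> q"
    by (rule multiplier_tensor_eqI) simp_all
  then show "\<iota> (\<Delta> a \<rhd> (p \<otimes> q)) = \<iota> (T1 \<Delta> (a \<otimes> q) \<lhd> (\<iota> p \<boxtimes> 1))"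
    by (simp add: multiplier_of_lact[symmetric] multiplier_of_ract[symmetric] multiplier_of_T1
        multiplier_of_tensor mult.assoc)
qed

end


section \<open>Multiplicativity of the counit\<close>

context weak_multiplier_hopf_algebra
begin

lemma clinear_counit: "clinear \<epsilon>"
  using counit by (simp add: counit_def)

lemma slice_counit_T1: "slice \<epsilon> (T1 \<Delta> (a \<otimes> b)) = a * b"
  using counit by (simp add: counit_def slice_def)

text \<open>
  Applying \<open>\<epsilon> \<otimes> id\<close> to \<open>\<Delta>(ab)(1 \<otimes> c) = \<Delta>(a) \<Delta>(b)(1 \<otimes> c)\<close> gives \<open>abc\<close> on the left, and on the right
  the factorisation of \<open>\<epsilon>\<close> first consumes \<open>\<Delta>(b)\<close>, which leaves \<open>(\<chi> \<otimes> id)(\<Delta>(a)(1 \<otimes> bc))\<close>.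
\<close>

lemma slice_factor_T1:
  assumes \<chi>: "clinear \<chi>" and factor: "\<And>a b. \<epsilon> (a * b) = \<chi> a * \<epsilon> b"
  shows "slice \<chi> (T1 \<Delta> (a \<otimes> d)) = a * d"
proof -
  note bil = cbilinearD[OF cbilinear_tensor]
  note sl\<epsilon> = clinear_slice[OF clinear_counit] and sl\<chi> = clinear_slice[OF \<chi>]
  have right: "slice \<epsilon> (y \<lhd> (\<iota> p \<boxtimes> 1)) = \<epsilon> p *\<^sub>C slice \<chi> y" for y :: "'a \<otimes> 'a" and p
    by (induction y rule: tensor_induct)
      (simp_all add: clinear_counit \<chi> factor clinear_add[OF sl\<epsilon>] clinear_add[OF sl\<chi>]
        clinear_add[OF clinear_ract] scaleC_add_right scaleC_scaleC mult.commute)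
  have Delta: "slice \<epsilon> (\<Delta> a \<rhd> y) = slice \<chi> (T1 \<Delta> (a \<otimes> slice \<epsilon> y))" for y
  proof (induction y rule: tensor_induct)
    case (tensor p q)
    show ?case
      by (simp add: Delta_lact_tensor right clinear_counit bil clinear_scaleC[OF clinear_T1]
          clinear_scaleC[OF sl\<chi>])
  qed (simp add: clinear_add[OF clinear_lact] clinear_add[OF sl\<epsilon>] clinear_add[OF sl\<chi>] bil
      clinear_add[OF clinear_T1])
  have product: "slice \<chi> (T1 \<Delta> (a \<otimes> (b * c))) = a * (b * c)" for b c
    using Delta[of "T1 \<Delta> (b \<otimes> c)"]
    by (simp add: T1_mult_left[symmetric] slice_counit_T1 mult.assoc)
  have "d \<in> complex_vector.span {a * b | a b :: 'a. True}"
    unfolding idempotent_algebra by (rule UNIV_I)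
  then show ?thesis
    by (induction rule: complex_vector.span_induct_alt)
      (auto simp: product bil clinear_add[OF clinear_T1] clinear_scaleC[OF clinear_T1]
        clinear_add[OF sl\<chi>] clinear_scaleC[OF sl\<chi>] distrib_left mult_scaleC_right
        clinear_zero[OF clinear_T1] clinear_zero[OF sl\<chi>]
        clinear_zero[OF conjunct2[OF cbilinear_tensor[unfolded cbilinear_def], THEN spec]])
qed

text \<open>
  Both \<open>\<chi>\<close> and \<open>\<epsilon>\<close> solve the left counit equation, so the left leg of \<open>\<Delta>\<close> lies in
  \<open>Ker (\<chi> - \<epsilon>)\<close>; by fullness this kernel is all of \<open>A\<close>.
\<close>

lemma factor_of_counit_eq:
  assumes \<chi>: "clinear \<chi>" and factor: "\<And>a b. \<epsilon> (a * b) = \<chi> a * \<epsilon> b"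
  shows "\<chi> = \<epsilon>"
proof (rule ccontr)
  assume "\<chi> \<noteq> \<epsilon>"
  then obtain w where w: "\<chi> w \<noteq> \<epsilon> w" by blast
  define \<phi> where "\<phi> = (\<lambda>x. \<chi> x - \<epsilon> x)"
  have \<phi>: "clinear \<phi>"
    using \<chi> clinear_counit by (simp add: \<phi>_def clinear_iff scaleC_complex_def algebra_simps)
  have slice: "slice \<phi> t = slice \<chi> t - slice \<epsilon> t" for t :: "'a \<otimes> 'a"
  proof (induction t rule: tensor_induct)
    case (tensor a b)
    have "\<phi> a *\<^sub>C b = \<chi> a *\<^sub>C b - \<epsilon> a *\<^sub>C b"
      by (simp add: \<phi>_def complex_vector.scale_left_diff_distrib)
    then show ?case
      by (simp add: \<phi> \<chi> clinear_counit)
  qed (simp add: \<phi> \<chi> clinear_counit clinear_add[OF clinear_slice])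
  have \<phi>w: "\<phi> w \<noteq> 0"
    using w by (simp add: \<phi>_def)
  then have "\<phi> (inverse (\<phi> w) *\<^sub>C w) = 1"
    by (simp add: clinear_scaleC[OF \<phi>] scaleC_complex_def)
  moreover have "slice \<phi> (T1 \<Delta> (a \<otimes> b)) = 0" for a b
    by (simp add: slice slice_factor_T1[OF assms] slice_counit_T1)
  ultimately have "T1 \<Delta> (a \<otimes> b) \<in> subspace_tensor {v. \<phi> v = 0} UNIV" for a b
    by (rule slice_eq_0_imp_in_kernel_tensor[OF \<phi>])
  then have "left_leg \<Delta> \<subseteq> {v. \<phi> v = 0}"
    unfolding left_leg_def using subspace_kernel[OF \<phi>] by blast
  then have "\<phi> w = 0"
    using full by (auto simp: full_def)
  then show False
    using \<phi>w by simp
qed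

lemma E_lact_T1: "E \<rhd> T1 \<Delta> x = T1 \<Delta> x"
proof -
  obtain y where "T1 \<Delta> x = E \<rhd> y"
    using range_T1 by blast
  then show ?thesis
    by (metis E_idempotent multiplier_action_simps(3))
qed

text \<open>
  A homomorphism \<open>\<epsilon> \<otimes> id\<close> extends to multipliers, and \<open>E\<close> is sent to an element that fixes every
  product \<open>ab = (\<epsilon> \<otimes> id)(\<Delta>(a)(1 \<otimes> b))\<close>, hence to \<open>1\<close>.
\<close>

lemma slice_counit_E:
  assumes mult: "\<And>x y. \<epsilon> (x * y) = \<epsilon> x * \<epsilon> y" and e: "\<epsilon> e = 1"
  shows "slice \<epsilon> (E \<rhd> x) = slice \<epsilon> x"
proof -
  note sl_mult = slice_mult[OF clinear_counit mult]
  have right: "slice \<epsilon> (y \<lhd> E) = slice \<epsilon> y" for y :: "'a \<otimes> 'a"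
  proof -
    have "slice \<epsilon> (y \<lhd> E) * (a * b) = slice \<epsilon> y * (a * b)" for a b
      using sl_mult[of "y \<lhd> E" "T1 \<Delta> (a \<otimes> b)"] sl_mult[of y "T1 \<Delta> (a \<otimes> b)"]
      by (simp add: ract_mult_lact E_lact_T1 slice_counit_T1)
    then have "(slice \<epsilon> (y \<lhd> E) - slice \<epsilon> y) * a * b = 0" for a b
      by (simp add: algebra_simps)
    then have "(slice \<epsilon> (y \<lhd> E) - slice \<epsilon> y) * a = 0" for a
      by (rule nondegenerate_left)
    then have "slice \<epsilon> (y \<lhd> E) - slice \<epsilon> y = 0"
      by (rule nondegenerate_left)
    then show ?thesis by simp
  qed
  have "slice \<epsilon> (e \<otimes> d) * slice \<epsilon> (E \<rhd> x) = slice \<epsilon> (e \<otimes> d) * slice \<epsilon> x" for d :: 'a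
    using sl_mult[of "e \<otimes> d" "E \<rhd> x"] sl_mult[of "(e \<otimes> d) \<lhd> E" x]
    by (simp add: ract_mult_lact right)
  then have "d * (slice \<epsilon> (E \<rhd> x) - slice \<epsilon> x) = 0" for d
    by (simp add: clinear_counit e scaleC_one algebra_simps)
  then have "slice \<epsilon> (E \<rhd> x) - slice \<epsilon> x = 0"
    by (rule nondegenerate_right)
  then show ?thesis by simp
qed

text \<open>
  The left counit law is given for \<open>\<Delta>(a)(1 \<otimes> b)\<close> only. Covering by \<open>c \<otimes> 1\<close> instead is harmless
  because the multiplicative \<open>\<epsilon>\<close> pulls out \<open>c\<close>; the factor \<open>1 \<otimes> b\<close> is added to use that law and
  then cancelled by non-degeneracy.
\<close>

lemma slice_counit_T2:
  assumes mult: "\<And>x y. \<epsilon> (x * y) = \<epsilon> x * \<epsilon> y"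
  shows "slice \<epsilon> (T2 \<Delta> (c \<otimes> a)) = \<epsilon> c *\<^sub>C a"
proof -
  have left: "slice \<epsilon> ((\<iota> c \<boxtimes> 1) \<rhd> y) = \<epsilon> c *\<^sub>C slice \<epsilon> y" for y :: "'a \<otimes> 'a"
    by (induction y rule: tensor_induct)
      (simp_all add: clinear_counit mult clinear_add[OF clinear_slice[OF clinear_counit]]
        clinear_add[OF clinear_lact] scaleC_add_right scaleC_scaleC)
  have "slice \<epsilon> (T2 \<Delta> (c \<otimes> a)) * b = \<epsilon> c *\<^sub>C a * b" for b
    by (simp add: slice_right_factor[OF clinear_counit, symmetric] T2_T1 left slice_counit_T1
        mult_scaleC_left)
  then have "(slice \<epsilon> (T2 \<Delta> (c \<otimes> a)) - \<epsilon> c *\<^sub>C a) * b = 0" for b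
    by (simp add: left_diff_distrib)
  then have "slice \<epsilon> (T2 \<Delta> (c \<otimes> a)) - \<epsilon> c *\<^sub>C a = 0"
    by (rule nondegenerate_left)
  then show ?thesis by simp
qed

end

context regular_weak_multiplier_hopf_algebra
begin

text \<open>
  Apply \<open>\<epsilon> \<otimes> id\<close> to the covered form \<open>(c \<otimes> d)E(a \<otimes> b) = \<Sum> c a\<^sub>1 \<otimes> d a\<^sub>2 S(a\<^sub>3) b\<close> of the formula
  for \<open>E\<close>. For a multiplicative \<open>\<epsilon>\<close> the factor \<open>E\<close> drops out on the left, while on the right
  \<open>\<Sum> \<epsilon>(c a\<^sub>1) a\<^sub>2 = \<epsilon>(c) a\<close> leaves \<open>\<epsilon>(c) \<Sum> d a\<^sub>1 S(a\<^sub>2) b\<close>. The cover \<open>c = e\<close> has \<open>\<epsilon>(c) = 1\<close>.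
\<close>

lemma sum_S_eq_counit:
  assumes mult: "\<And>x y. \<epsilon> (x * y) = \<epsilon> x * \<epsilon> y" and e: "\<epsilon> e = 1"
  shows "mult_id_S S (T2 \<Delta> (d \<otimes> a)) = \<epsilon> a *\<^sub>C d"
proof -
  note bil = cbilinearD[OF cbilinear_tensor] and sl = clinear_slice[OF clinear_counit]
  define D where "D = (\<lambda>q. mult_id_S S (T2 \<Delta> (d \<otimes> q)))"
  have S: "clinear S"
    and formula: "sweedler_id_idS \<Delta> S a b (E \<rhd> (a \<otimes> b))" for a b
    using antipode by (simp_all add: antipode_def)
  have "clinear (mult_id_S S)"
    unfolding mult_id_S_def
    by (rule lift_clinear, rule cbilinearI)
      (simp_all add: clinear_add[OF clinear_ract] clinear_scaleC[OF clinear_ract]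
        clinear_add[OF S] clinear_scaleC[OF S] ract_add ract_scaleC)
  then have D: "clinear D"
    by (simp add: D_def clinear_iff bil clinear_add[OF clinear_T2] clinear_scaleC[OF clinear_T2])
  have slice_D: "slice \<epsilon> (lift (\<lambda>p q. p \<otimes> (D q * b)) t) = D (slice \<epsilon> t) * b" for b t
  proof -
    have g: "cbilinear (\<lambda>p q. (p :: 'a) \<otimes> (D q * b))"
      by (rule cbilinearI)
        (simp_all add: bil clinear_add[OF D] clinear_scaleC[OF D] distrib_right mult_scaleC_left)
    show ?thesis
      by (induction t rule: tensor_induct)
        (simp_all add: g clinear_counit clinear_add[OF lift_clinear] clinear_add[OF sl]
          clinear_add[OF D] clinear_scaleC[OF D] distrib_right mult_scaleC_left)
  qed
  have "\<epsilon> a *\<^sub>C d * b = D a * b" for b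
  proof -
    have "(e \<otimes> d) * (E \<rhd> (a \<otimes> b)) =
        lift (\<lambda>p q. p \<otimes> (D q * b)) (T2 \<Delta> (e \<otimes> a))"
      using formula[of a b] by (simp add: sweedler_id_idS_def D_def)
    then have "slice \<epsilon> (e \<otimes> d) * slice \<epsilon> (E \<rhd> (a \<otimes> b)) =
        D (slice \<epsilon> (T2 \<Delta> (e \<otimes> a))) * b"
      by (simp only: slice_D slice_mult[OF clinear_counit mult, symmetric])
    then show ?thesis
      by (simp add: slice_counit_E[OF mult e] slice_counit_T2[OF mult] clinear_counit e scaleC_one
          mult_scaleC_left mult_scaleC_right)
  qed
  then have "(D a - \<epsilon> a *\<^sub>C d) * b = 0" for b
    by (simp add: left_diff_distrib)
  then have "D a - \<epsilon> a *\<^sub>C d = 0"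
    by (rule nondegenerate_left)
  then show ?thesis by (simp add: D_def)
qed

text \<open>
  The multiplier \<open>\<epsilon>\<^sub>t(a)\<close> is pinned down by its right action alone, as the left action of a
  multiplier of a non-degenerate algebra is determined by the right one.
\<close>

lemma epsilon_t_eq_counit:
  assumes mult: "\<And>x y. \<epsilon> (x * y) = \<epsilon> x * \<epsilon> y" and e: "\<epsilon> e = 1"
  shows "epsilon_t \<Delta> S a = \<epsilon> a *\<^sub>C 1"
  unfolding epsilon_t_def sum_S_eq_counit[OF assms]
proof (rule the_equality)
  show "\<forall>c. c \<lhd> (\<epsilon> a *\<^sub>C 1) = \<epsilon> a *\<^sub>C c"
    by (simp add: ract_scaleC)
  fix m :: "'a multiplier" assume m: "\<forall>c. c \<lhd> m = \<epsilon> a *\<^sub>C c"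
  show "m = \<epsilon> a *\<^sub>C 1"
  proof (rule multiplier_eqI)
    fix x
    have "c * (m \<rhd> x - \<epsilon> a *\<^sub>C x) = 0" for c
      using ract_mult_lact[of c m x] m
      by (simp add: right_diff_distrib mult_scaleC_left mult_scaleC_right)
    then have "m \<rhd> x - \<epsilon> a *\<^sub>C x = 0"
      by (rule nondegenerate_right)
    then show "m \<rhd> x = (\<epsilon> a *\<^sub>C 1) \<rhd> x"
      by (simp add: lact_scaleC)
  qed (simp add: m ract_scaleC)
qed

end


section \<open>Existence of a cointegral\<close>

theorem proposition4p19:
  fixes \<Delta> :: "'a::nondegenerate_algebra \<Rightarrow> ('a \<otimes> 'a) multiplier"
    and \<epsilon> :: "'a \<Rightarrow> complex"
    and E :: "('a \<otimes> 'a) multiplier"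
    and G1 G2 :: "'a \<otimes> 'a \<Rightarrow> 'a \<otimes> 'a"
    and S :: "'a \<Rightarrow> 'a multiplier"
    and I :: "'a set"
  assumes "regular_weak_multiplier_hopf_algebra \<Delta> \<epsilon> E G1 G2 S"
    and "I = {a. \<epsilon> a = 0}"
    and "\<exists>h. h \<noteq> 0 \<and> (\<forall>a\<in>I. a * h = 0)"
  shows "\<exists>k. left_cointegral \<Delta> S k"
proof -
  interpret regular_weak_multiplier_hopf_algebra \<Delta> \<epsilon> E G1 G2 S by (rule assms(1))
  note \<epsilon> = clinear_counit
  obtain h where h: "h \<noteq> 0" and kill: "\<epsilon> a = 0 \<Longrightarrow> a * h = 0" for a
    using assms(2,3) by auto
  have not_killed: "\<exists>a. a * h \<noteq> 0"
    using nondegenerate_right[of h] h by blast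
  then obtain a0 where "\<epsilon> a0 \<noteq> 0"
    using kill by blast
  then have "\<epsilon> (inverse (\<epsilon> a0) *\<^sub>C a0) = 1"
    by (simp add: clinear_scaleC[OF \<epsilon>] scaleC_complex_def)
  then obtain e where e: "\<epsilon> e = 1" by blast
  define k where "k = e * h"
  define \<chi> where "\<chi> = (\<lambda>a. \<epsilon> (a * e))"
  have ah: "a * h = \<epsilon> a *\<^sub>C k" for a
  proof -
    have "\<epsilon> (a - \<epsilon> a *\<^sub>C e) = 0"
      using clinear_add[OF \<epsilon>, of "a - \<epsilon> a *\<^sub>C e" "\<epsilon> a *\<^sub>C e"]
      by (simp add: clinear_scaleC[OF \<epsilon>] e scaleC_complex_def)
    then show ?thesis
      using kill[of "a - \<epsilon> a *\<^sub>C e"] by (simp add: k_def left_diff_distrib mult_scaleC_left)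
  qed
  have k: "k \<noteq> 0"
    using not_killed ah by auto
  have abk: "\<epsilon> (a * b) *\<^sub>C k = \<epsilon> b *\<^sub>C (a * k)" for a b
    using ah[of "a * b"] by (simp add: mult.assoc ah[of b] mult_scaleC_right)
  have ak: "a * k = \<chi> a *\<^sub>C k" for a
    using abk[of a e] by (simp add: e \<chi>_def scaleC_one)
  have "\<epsilon> (a * b) = \<chi> a * \<epsilon> b" for a b
    using abk[of a b] k by (simp add: ak scaleC_scaleC mult.commute)
  moreover have "clinear \<chi>"
    by (simp add: \<chi>_def clinear_iff clinear_add[OF \<epsilon>] clinear_scaleC[OF \<epsilon>] distrib_right
        mult_scaleC_left)
  ultimately have "\<chi> = \<epsilon>" and mult: "\<epsilon> (a * b) = \<epsilon> a * \<epsilon> b" for a b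
    using factor_of_counit_eq[of \<chi>] by auto
  have "\<iota> a * \<iota> k = epsilon_t \<Delta> S a * \<iota> k" for a
    by (simp add: epsilon_t_eq_counit[OF mult e] multiplier_of_mult[symmetric] ak \<open>\<chi> = \<epsilon>\<close>
        clinear_scaleC[OF clinear_multiplier_of] mult_scaleC_left)
  moreover have "\<iota> k \<noteq> 0"
    using k inj_multiplier_of clinear_zero[OF clinear_multiplier_of] by (metis injD)
  ultimately show ?thesis
    by (auto simp: left_cointegral_def)
qed

end
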